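(* Let $\mathscr{T}=\{a,b,c\}$, $I=\{1,2,3\}$, and let $\mathfrak{N}=\mathrm{TP}(\xi)$ be the simple system of triangle perspectives determined by one of the following fourteen triples: (i) $\xi(1,2)=\xi(2,3)=\xi(1,3)=\rho$; (ii) $\xi(1,2)=\xi(2,3)=\rho$, $\xi(1,3)=\mathrm{id}$; (iii) $\xi(1,2)=\rho$, $\xi(1,3)=\xi(2,3)=\mathrm{id}$; (iv) $\xi(1,2)=\xi(2,3)=\xi(3,1)=\rho$; (v) $\xi(1,2)=\xi(3,2)=\rho$, $\xi(1,3)=\mathrm{id}$; (vi) $\xi(1,2)=\sigma_a$, $\xi(1,3)=\sigma_c$, $\xi(2,3)=\sigma_b$; (vii) $\xi(1,2)=\sigma_a$, $\xi(2,3)=\sigma_c$, $\xi(1,3)=\mathrm{id}$; (viii) $\xi(1,2)=\sigma_a$, $\xi(2,3)=\rho$, $\xi(1,3)=\mathrm{id}$; (ix) $\xi(1,2)=\sigma_a$, $\xi(2,3)=\sigma_c$, $\xi(1,3)=\rho$; (x) $\xi(1,2)=\sigma_a$, $\xi(2,3)=\sigma_c$, $\xi(3,1)=\rho$; (xi) $\xi(1,2)=\xi(2,3)=\sigma_c$, $\xi(1,3)=\sigma_a$; (xii) $\xi(1,2)=\xi(2,3)=\sigma_c$, $\xi(1,3)=\rho$; (xiii) $\xi(1,2)=\xi(2,3)=\rho$, $\xi(1,3)=\sigma_c$; (xiv) $\xi(1,2)=\rho$, $\xi(2,3)=\rho^{-1}$, $\xi(1,3)=\sigma_c$. Then the group $\mathfrak{G}$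 of automorphisms of $\mathfrak{N}$ consists of exactly the maps $\beta\times\alpha$ with $\alpha\in S_I$ and $\beta\in S_{\mathscr{T}}$ such that: - cases (i), (ii), (iii): either $\alpha=\mathrm{id}$ and $\beta\in P$, or $\alpha=\sigma_{i_0}$ and $\beta=\sigma_x$ with $x\in\mathscr{T}$, where $i_0=2$, $i_0=2$, $i_0=3$ in cases (i), (ii), (iii) respectively; then $\mathfrak{G}\cong C_2\ltimes C_3=S_3$; - case (iv): either $\alpha\in R$ and $\beta\in P$, or $(\alpha,\beta)=(\sigma_i,\sigma_x)$ with $x\in\mathscr{T}$, $i\in I$; then $\mathfrak{G}\cong C_2\ltimes(C_3\oplus C_3)$; - case (v): $\alpha\in\{\mathrm{id},\sigma_2\}$ and $\beta\in P$; then $\mathfrak{G}\cong C_2\oplus C_3$; - case (vi): either $(\alpha,\beta)=(\varrho^m,\rho^m)$ with $m=0,1,2$, or $(\alpha,\beta)=(\sigma_i,\sigma_x)$ with $(x,i)\in\{(b,1),(c,2),(a,3)\}$; then $\mathfrak{G}\cong S_{\mathscr{T}}=S_3$; - cases (vii), (ix), (x), (xii), (xiii): either $(\alpha,\beta)=(\mathrm{id},\mathrm{id})$ or $(\alpha,\beta)=(\sigma_2,\sigma_{x_0})$, where $x_0=b,b,b,c,c$ in cases (vii), (ix), (x), (xii), (xiii) respectively; then $\mathfrak{G}\cong C_2$; - case (viii): $\alpha=\mathrm{id}$, $\beta=\mathrm{id}$; - cases (xi), (xiv): $\alpha\in\{\mathrm{id},\sigma_2\}$ and $\beta=\mathrm{id}$;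 then $\mathfrak{G}\cong C_2$.
   Context: $S_{\mathscr{T}}$ and $S_I$ are the symmetric groups on $\mathscr{T}=\{a,b,c\}$ and $I=\{1,2,3\}$; $C_k$ is the cyclic group of order $k$. The permutation $\rho\in S_{\mathscr{T}}$ is given by $\rho(a)=b$, $\rho(b)=c$, $\rho(c)=a$; for $x\in\mathscr{T}$, $\sigma_x\in S_{\mathscr{T}}$ is the transposition fixing $x$ and interchanging the other two elements. $P$ is the group generated by $\rho$. For $i\in I$, $\sigma_i\in S_I$ is the transposition of the elements of $I\setminus\{i\}$; $\varrho\in S_I$ is the cycle $1\mapsto2\mapsto3\mapsto1$, and $R$ is the group generated by $\varrho$. Let $\xi\colon I\times I\to S_{\mathscr{T}}$ satisfy $\xi(i,i)=\mathrm{id}$ and $\xi(j,i)=\xi(i,j)^{-1}$ for all $i,j\in I$. The simple system of triangle perspectives $\mathrm{TP}(\xi)$ is the incidence structure with the $15$ pairwise distinct points $q^a,q^b,q^c$; $a_i,b_i,c_i$ ($i\in I$); $q^{i,j}=q^{j,i}$ ($i\neq j$ in $I$), and the following lines (sets of points): $L=\{q^a,q^b,q^c\}$; $A_i=\{q^a,b_i,c_i\}$, $B_i=\{q^b,a_i,c_i\}$, $C_i=\{q^c,a_i,b_i\}$ for $i\in I$; $\{q^{i,j},x_i,(\xi(i,j)(x))_j\}$ for distinct $i,j\in I$ and $x\in\mathscr{T}$; and $\{q^{1,2},q^{1,3},q^{2,3}\}$. An automorphism is a permutation of the points mapping the set of lines onto itself. For $\alpha\in S_I$, $\beta\in S_{\mathscr{T}}$,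 the map $\beta\times\alpha$ on the points is given by $x_i\mapsto(\beta(x))_{\alpha(i)}$, $q^x\mapsto q^{\beta(x)}$, $q^{i,j}\mapsto q^{\alpha(i),\alpha(j)}$ for $x\in\mathscr{T}$ and $i,j\in I$. *)

theory Defs
  imports "HOL-Algebra.Bij" "HOL-Algebra.Elementary_Groups"
    "HOL-Algebra.Generated_Groups" "HOL-Algebra.Sym_Groups"
begin

section \<open>The symmetric groups on the two index sets\<close>

datatype tri = Ta | Tb | Tc

datatype idx = I1 | I2 | I3

abbreviation S_tri :: "(tri \<Rightarrow> tri) monoid"
  where "S_tri \<equiv> BijGroup UNIV"

abbreviation S_idx :: "(idx \<Rightarrow> idx) monoid"
  where "S_idx \<equiv> BijGroup UNIV"

fun rho :: "tri \<Rightarrow> tri" where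
  "rho Ta = Tb"
| "rho Tb = Tc"
| "rho Tc = Ta"

fun sigma :: "tri \<Rightarrow> tri \<Rightarrow> tri" where
  "sigma Ta = Transposition.transpose Tb Tc"
| "sigma Tb = Transposition.transpose Ta Tc"
| "sigma Tc = Transposition.transpose Ta Tb"

fun varrho :: "idx \<Rightarrow> idx" where
  "varrho I1 = I2"
| "varrho I2 = I3"
| "varrho I3 = I1"

fun sigma_idx :: "idx \<Rightarrow> idx \<Rightarrow> idx" where
  "sigma_idx I1 = Transposition.transpose I2 I3"
| "sigma_idx I2 = Transposition.transpose I1 I3"
| "sigma_idx I3 = Transposition.transpose I1 I2"

definition P_rho :: "(tri \<Rightarrow> tri) set"
  where "P_rho = generate S_tri {rho}"

definition R_varrho :: "(idx \<Rightarrow> idx) set"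
  where "R_varrho = generate S_idx {varrho}"


section \<open>Automorphisms of an incidence structure\<close>

text \<open>As in \<^const>\<open>BijGroup\<close>, a permutation of the point set \<open>X\<close> is represented by a function
  that is \<^const>\<open>undefined\<close> outside \<open>X\<close>.\<close>

definition incidence_automorphism_group :: "'p set \<Rightarrow> 'p set set \<Rightarrow> ('p \<Rightarrow> 'p) monoid"
  where "incidence_automorphism_group X \<L> =
    (BijGroup X)\<lparr>carrier := {f \<in> Bij X. image f ` \<L> = \<L>}\<rparr>"

lemma subgroup_incidence_automorphisms:
  assumes "\<Union>\<L> \<subseteq> X"
  shows "subgroup (carrier (incidence_automorphism_group X \<L>)) (BijGroup X)"
proof -
  interpret B: group "BijGroup X" by (rule group_BijGroup)
  have comp: "image (compose X f g) ` \<L> = image f ` image g ` \<L>"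
    for f g :: "'a \<Rightarrow> 'a"
  proof -
    have "compose X f g ` l = f ` g ` l" if "l \<in> \<L>" for l
      using that assms by (force simp: compose_def image_iff)
    then show ?thesis by (force simp: image_iff)
  qed
  have car: "carrier (BijGroup X) = Bij X" by (simp add: BijGroup_def)
  have mult: "f \<otimes>\<^bsub>BijGroup X\<^esub> g = compose X f g" if "f \<in> Bij X" "g \<in> Bij X" for f g
    using that by (simp add: BijGroup_def)
  have one: "\<one>\<^bsub>BijGroup X\<^esub> = (\<lambda>x\<in>X. x)" by (simp add: BijGroup_def)
  have idl: "image (\<lambda>x\<in>X. x) ` \<L> = \<L>"
  proof -
    have "(\<lambda>x\<in>X. x) ` l = l" if "l \<in> \<L>" for l
      using that assms by (force simp: image_iff)
    then show ?thesis by (force simp: image_iff)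
  qed
  let ?C = "{f \<in> Bij X. image f ` \<L> = \<L>}"
  have "subgroup ?C (BijGroup X)"
  proof (rule B.subgroupI)
    show "?C \<subseteq> carrier (BijGroup X)" by (auto simp: car)
    show "?C \<noteq> {}" using idl id_Bij[of X] by blast
    show "f \<otimes>\<^bsub>BijGroup X\<^esub> g \<in> ?C" if "f \<in> ?C" "g \<in> ?C" for f g
      using that comp[of f g] by (simp add: mult compose_Bij)
    show "inv\<^bsub>BijGroup X\<^esub> f \<in> ?C" if "f \<in> ?C" for f
    proof -
      let ?g = "inv\<^bsub>BijGroup X\<^esub> f"
      have f: "f \<in> Bij X" "image f ` \<L> = \<L>" using that by auto
      have g: "?g \<in> Bij X" using B.inv_closed[of f] f by (simp add: car)
      have "compose X ?g f = (\<lambda>x\<in>X. x)"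
        using B.l_inv[of f] f g by (simp add: car mult one)
      then have "image ?g ` image f ` \<L> = \<L>" using comp[of ?g f] idl by simp
      with f g show ?thesis by simp
    qed
  qed
  then show ?thesis by (simp add: incidence_automorphism_group_def)
qed

lemma group_incidence_automorphism_group:
  assumes "\<Union>\<L> \<subseteq> X"
  shows "group (incidence_automorphism_group X \<L>)"
  using subgroup.subgroup_is_group[OF subgroup_incidence_automorphisms[OF assms] group_BijGroup]
  by (simp add: incidence_automorphism_group_def)


section \<open>Simple systems of triangle perspectives\<close>

text \<open>\<open>Q x\<close> is $q^x$, \<open>V x i\<close> is $x_i$, and \<open>qq i j\<close> is $q^{i,j} = q^{j,i}$, encoded through the
  unordered pair. Values \<open>E e\<close> with \<open>e\<close> not a two-element set are not points, hence the explicit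
  point set.\<close>

datatype point = Q tri | V tri idx | E "idx set"

abbreviation qq :: "idx \<Rightarrow> idx \<Rightarrow> point"
  where "qq i j \<equiv> E {i, j}"

definition tp_points :: "point set"
  where "tp_points = range Q \<union> {V x i |x i. True} \<union> {qq i j |i j. i \<noteq> j}"

definition perspective_datum :: "(idx \<Rightarrow> idx \<Rightarrow> tri \<Rightarrow> tri) \<Rightarrow> bool"
  where "perspective_datum \<xi> \<longleftrightarrow>
    (\<forall>i j. \<xi> i j \<in> carrier S_tri) \<and>
    (\<forall>i. \<xi> i i = id) \<and>
    (\<forall>i j. \<xi> j i = inv\<^bsub>S_tri\<^esub> (\<xi> i j))"

definition tp_lines :: "(idx \<Rightarrow> idx \<Rightarrow> tri \<Rightarrow> tri) \<Rightarrow> point set set"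
  where "tp_lines \<xi> =
    {{Q Ta, Q Tb, Q Tc}} \<union>
    {{Q Ta, V Tb i, V Tc i} |i. True} \<union>
    {{Q Tb, V Ta i, V Tc i} |i. True} \<union>
    {{Q Tc, V Ta i, V Tb i} |i. True} \<union>
    {{qq i j, V x i, V (\<xi> i j x) j} |i j x. i \<noteq> j} \<union>
    {{qq I1 I2, qq I1 I3, qq I2 I3}}"

definition tp_aut_group :: "(idx \<Rightarrow> idx \<Rightarrow> tri \<Rightarrow> tri) \<Rightarrow> (point \<Rightarrow> point) monoid"
  where "tp_aut_group \<xi> = incidence_automorphism_group tp_points (tp_lines \<xi>)"

lemma Union_tp_lines: "\<Union>(tp_lines \<xi>) \<subseteq> tp_points"
  by (auto simp: tp_lines_def tp_points_def)

lemma group_tp_aut_group: "group (tp_aut_group \<xi>)"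
  unfolding tp_aut_group_def by (rule group_incidence_automorphism_group[OF Union_tp_lines])

definition times_map :: "(tri \<Rightarrow> tri) \<Rightarrow> (idx \<Rightarrow> idx) \<Rightarrow> point \<Rightarrow> point"
  where "times_map \<beta> \<alpha> = (\<lambda>p\<in>tp_points. case p of
      Q x \<Rightarrow> Q (\<beta> x)
    | V x i \<Rightarrow> V (\<beta> x) (\<alpha> i)
    | E e \<Rightarrow> E (\<alpha> ` e))"

lemma times_map_simps:
  "times_map \<beta> \<alpha> (Q x) = Q (\<beta> x)"
  "times_map \<beta> \<alpha> (V x i) = V (\<beta> x) (\<alpha> i)"
  "i \<noteq> j \<Longrightarrow> times_map \<beta> \<alpha> (qq i j) = qq (\<alpha> i) (\<alpha> j)"
  by (auto simp: times_map_def tp_points_def)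


section \<open>Semidirect products\<close>

text \<open>The pair \<open>(h, n)\<close> stands for the product $n h$, where \<open>h\<close> acts on \<open>N\<close> by \<open>\<phi> h\<close>.\<close>

definition semidirect ::
  "'h monoid \<Rightarrow> ('h \<Rightarrow> 'n \<Rightarrow> 'n) \<Rightarrow> 'n monoid \<Rightarrow> ('h \<times> 'n) monoid"
  where "semidirect H \<phi> N =
    \<lparr>carrier = carrier H \<times> carrier N,
     monoid.mult = (\<lambda>(h, n) (h', n'). (h \<otimes>\<^bsub>H\<^esub> h', n \<otimes>\<^bsub>N\<^esub> \<phi> h n')),
     one = (\<one>\<^bsub>H\<^esub>, \<one>\<^bsub>N\<^esub>)\<rparr>"

text \<open>The generator of \<open>C\<^sub>2\<close> inverts every element of \<open>N\<close>; this is an action by automorphisms when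
  \<open>N\<close> is commutative.\<close>

definition inversion_action :: "('n, 'b) monoid_scheme \<Rightarrow> int \<Rightarrow> 'n \<Rightarrow> 'n"
  where "inversion_action N h = (\<lambda>n\<in>carrier N. if h = 0 then n else inv\<^bsub>N\<^esub> n)"

abbreviation cyclic_semidirect :: "'n monoid \<Rightarrow> (int \<times> 'n) monoid"
  where "cyclic_semidirect N \<equiv> semidirect (integer_mod_group 2) (inversion_action N) N"

lemma group_semidirect:
  assumes "group H" "group N" and phi: "\<phi> \<in> hom H (AutoGroup N)"
  shows "group (semidirect H \<phi> N)"
proof -
  interpret H: group H by fact
  interpret N: group N by fact
  have auto: "\<phi> h \<in> auto N" if "h \<in> carrier H" for h
    using phi that by (auto simp: hom_def AutoGroup_def)
  then have bij: "\<phi> h \<in> Bij (carrier N)" and hom: "\<phi> h \<in> hom N N" if "h \<in> carrier H" for h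
    using that by (auto simp: auto_def)
  have closed: "\<phi> h n \<in> carrier N" if "h \<in> carrier H" "n \<in> carrier N" for h n
    using hom that by (auto simp: hom_def)
  have mult: "\<phi> h (m \<otimes>\<^bsub>N\<^esub> n) = \<phi> h m \<otimes>\<^bsub>N\<^esub> \<phi> h n"
    if "h \<in> carrier H" "m \<in> carrier N" "n \<in> carrier N" for h m n
    using hom that by (auto simp: hom_def)
  have act: "\<phi> (g \<otimes>\<^bsub>H\<^esub> h) n = \<phi> g (\<phi> h n)"
    if "g \<in> carrier H" "h \<in> carrier H" "n \<in> carrier N" for g h n
    using phi that bij by (auto simp: hom_def AutoGroup_def BijGroup_def compose_def)
  have one: "\<phi> \<one>\<^bsub>H\<^esub> n = n" if "n \<in> carrier N" for n
  proof -
    have "inj_on (\<phi> \<one>\<^bsub>H\<^esub>) (carrier N)"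
      using bij[OF H.one_closed] by (auto simp: Bij_def bij_betw_def)
    moreover have "\<phi> \<one>\<^bsub>H\<^esub> (\<phi> \<one>\<^bsub>H\<^esub> n) = \<phi> \<one>\<^bsub>H\<^esub> n"
      using act[of "\<one>\<^bsub>H\<^esub>" "\<one>\<^bsub>H\<^esub>" n] that by simp
    ultimately show ?thesis
      using that closed[OF H.one_closed that] by (auto dest: inj_onD)
  qed
  have phi_one: "\<phi> h \<one>\<^bsub>N\<^esub> = \<one>\<^bsub>N\<^esub>" if "h \<in> carrier H" for h
    using hom[OF that] by (rule hom_one) fact+
  show ?thesis
  proof (rule groupI)
    fix x assume "x \<in> carrier (semidirect H \<phi> N)"
    then obtain h n where x: "x = (h, n)" "h \<in> carrier H" "n \<in> carrier N"
      by (auto simp: semidirect_def)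
    let ?y = "(inv\<^bsub>H\<^esub> h, \<phi> (inv\<^bsub>H\<^esub> h) (inv\<^bsub>N\<^esub> n))"
    have "\<phi> (inv\<^bsub>H\<^esub> h) (inv\<^bsub>N\<^esub> n) \<otimes>\<^bsub>N\<^esub> \<phi> (inv\<^bsub>H\<^esub> h) n = \<one>\<^bsub>N\<^esub>"
      using x mult[of "inv\<^bsub>H\<^esub> h" "inv\<^bsub>N\<^esub> n" n] phi_one by simp
    then have "?y \<otimes>\<^bsub>semidirect H \<phi> N\<^esub> x = \<one>\<^bsub>semidirect H \<phi> N\<^esub>"
      using x by (simp add: semidirect_def)
    moreover have "?y \<in> carrier (semidirect H \<phi> N)"
      using x closed by (simp add: semidirect_def)
    ultimately show "\<exists>y\<in>carrier (semidirect H \<phi> N).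
        y \<otimes>\<^bsub>semidirect H \<phi> N\<^esub> x = \<one>\<^bsub>semidirect H \<phi> N\<^esub>" by blast
  qed (auto simp: semidirect_def closed mult act one H.m_assoc N.m_assoc)
qed

lemma inversion_action_hom:
  assumes "comm_group N"
  shows "inversion_action N \<in> hom (integer_mod_group 2) (AutoGroup N)"
proof -
  interpret N: comm_group N by fact
  have bij: "inversion_action N h \<in> Bij (carrier N)" for h
    unfolding Bij_def inversion_action_def
    by (auto intro!: bij_betw_byWitness[where f' = "\<lambda>n. if h = 0 then n else inv\<^bsub>N\<^esub> n"])
  then have "inversion_action N h \<in> auto N" for h
    by (auto simp: auto_def hom_def inversion_action_def N.inv_mult)
  moreover have "inversion_action N ((g + h) mod 2) =
      compose (carrier N) (inversion_action N g) (inversion_action N h)"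
    if "g \<in> {0..<2}" "h \<in> {0..<2}" for g h :: int
  proof -
    from that have "g = 0 \<or> g = 1" "h = 0 \<or> h = 1" by auto
    then show ?thesis by (auto simp: inversion_action_def compose_def fun_eq_iff)
  qed
  ultimately show ?thesis
    by (auto simp: hom_def AutoGroup_def BijGroup_def bij carrier_integer_mod_group)
qed

end

theory Submission
  imports Defs
begin

text \<open>
  Call a point \<open>p\<close> of a configuration a Veblen point if every point \<open>x\<close> collinear with \<open>p\<close> is collinear
  with (or lies on) a further point of every line through \<open>p\<close>. The points $q^{i,j}$ always have
  this property, whereas $q^x$ and $x_i$ have it only if \<open>x\<close> is fixed by all the \<open>\<xi> i j\<close>. If no
  \<open>x\<close> is fixed by all of them, as in each of the fourteen cases, an automorphism therefore permutes
  the $q^{i,j}$, hence the $q^x$ (the points collinear with no $q^{i,j}$), and $x_i$ is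
  determined by the single $q^y$ and the single $q^{j,k}$ not collinear with it. So every
  automorphism is \<open>\<beta> \<times> \<alpha>\<close>, and such a map is an automorphism iff
  \<open>\<xi> (\<alpha> i) (\<alpha> j) \<circ> \<beta> = \<beta> \<circ> \<xi> i j\<close>, a condition on 36 pairs.
\<close>

section \<open>Automorphisms and collinearity\<close>

definition joined :: "'p set set \<Rightarrow> 'p \<Rightarrow> 'p \<Rightarrow> bool"
  where "joined \<L> p q \<longleftrightarrow> p \<noteq> q \<and> (\<exists>l\<in>\<L>. p \<in> l \<and> q \<in> l)"

text \<open>Since \<open>joined\<close> is irreflexive, the disjunct \<open>y = x\<close> is what
  covers lines \<open>m\<close> through \<open>x\<close>. Only incidence occurs here, so the notion
  is transported by automorphisms.\<close>

definition veblen_point :: "'p set set \<Rightarrow> 'p \<Rightarrow> bool"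
  where "veblen_point \<L> p \<longleftrightarrow>
    (\<forall>x m. joined \<L> p x \<longrightarrow> m \<in> \<L> \<longrightarrow> p \<in> m \<longrightarrow> (\<exists>y\<in>m. y \<noteq> p \<and> (y = x \<or> joined \<L> x y)))"

lemma joinedI: "l \<in> \<L> \<Longrightarrow> p \<in> l \<Longrightarrow> q \<in> l \<Longrightarrow> p \<noteq> q \<Longrightarrow> joined \<L> p q"
  by (auto simp: joined_def)

lemma incidence_automorphismD:
  assumes "f \<in> carrier (incidence_automorphism_group X \<L>)"
  shows "f \<in> Bij X" "inj_on f X" "f ` X = X" "image f ` \<L> = \<L>"
  using assms by (auto simp: incidence_automorphism_group_def Bij_def bij_betw_def)

text \<open>Injectivity lets incidence be read back through \<open>f\<close>, and the line set is
  its own image, so every line through \<open>f p\<close> and \<open>f q\<close> is the image of a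
  line through \<open>p\<close> and \<open>q\<close>.\<close>

lemma joined_automorphism:
  assumes f: "f \<in> carrier (incidence_automorphism_group X \<L>)" and "\<Union>\<L> \<subseteq> X" "p \<in> X" "q \<in> X"
  shows "joined \<L> (f p) (f q) \<longleftrightarrow> joined \<L> p q"
proof -
  note f = incidence_automorphismD[OF f]
  have mem: "f r \<in> f ` l \<longleftrightarrow> r \<in> l" if "r \<in> X" "l \<in> \<L>" for r l
    using that assms(2) by (intro inj_on_image_mem_iff[OF f(2)]) auto
  have "(\<exists>l\<in>\<L>. f p \<in> l \<and> f q \<in> l) \<longleftrightarrow> (\<exists>l\<in>image f ` \<L>. f p \<in> l \<and> f q \<in> l)"
    by (simp add: f(4))
  also have "\<dots> \<longleftrightarrow> (\<exists>l\<in>\<L>. p \<in> l \<and> q \<in> l)"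
    using mem assms(3,4) by auto
  finally show ?thesis
    using f(2) assms(3,4) by (auto simp: joined_def dest: inj_onD)
qed

text \<open>A test point and a test line at \<open>f p\<close> are pulled back to \<open>p\<close>,
  where the hypothesis supplies \<open>y\<close>; then \<open>f y\<close> is the required
  witness.\<close>

lemma veblen_point_automorphism:
  assumes f: "f \<in> carrier (incidence_automorphism_group X \<L>)" and X: "\<Union>\<L> \<subseteq> X"
    and "p \<in> X" "veblen_point \<L> p"
  shows "veblen_point \<L> (f p)"
  unfolding veblen_point_def
proof (intro allI impI)
  fix x' m' assume x': "joined \<L> (f p) x'" and m': "m' \<in> \<L>" "f p \<in> m'"
  note f' = incidence_automorphismD[OF f]
  have "x' \<in> X" using x' X by (auto simp: joined_def)
  then obtain x where x: "x \<in> X" "x' = f x" using f'(3) by blast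
  obtain m where m: "m \<in> \<L>" "m' = f ` m" using f'(4) m' by blast
  have "m \<subseteq> X" using X m by auto
  have "p \<in> m" using m m' \<open>m \<subseteq> X\<close> \<open>p \<in> X\<close> inj_on_image_mem_iff[OF f'(2)] by auto
  moreover have "joined \<L> p x" using x x' joined_automorphism[OF f X \<open>p \<in> X\<close>] by simp
  ultimately obtain y where y: "y \<in> m" "y \<noteq> p" "y = x \<or> joined \<L> x y"
    using assms(4) m(1) unfolding veblen_point_def by blast
  then have "f y \<noteq> f p" using \<open>m \<subseteq> X\<close> \<open>p \<in> X\<close> f'(2) by (auto dest: inj_onD)
  with y x m \<open>m \<subseteq> X\<close> show "\<exists>y\<in>m'. y \<noteq> f p \<and> (y = x' \<or> joined \<L> x' y)"
    using joined_automorphism[OF f X] by (intro bexI[of _ "f y"]) auto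
qed

section \<open>Collinearity in a system of triangle perspectives\<close>

lemma UNIV_tri: "UNIV = {Ta, Tb, Tc}"
  using tri.exhaust by auto

lemma UNIV_idx: "UNIV = {I1, I2, I3}"
  using idx.exhaust by auto

instance tri :: finite
  by standard (simp add: UNIV_tri)

instance idx :: finite
  by standard (simp add: UNIV_idx)

lemma all_tri: "(\<forall>x. P x) \<longleftrightarrow> P Ta \<and> P Tb \<and> P Tc"
  by (metis tri.exhaust)

lemma all_idx: "(\<forall>i. P i) \<longleftrightarrow> P I1 \<and> P I2 \<and> P I3"
  by (metis idx.exhaust)

lemma compl_idx: "- {I1} = {I2, I3}" "- {I2} = {I1, I3}" "- {I3} = {I1, I2}"
  by (auto simp: set_eq_iff all_idx)

text \<open>Among three indices, a two-element set is the complement of the index left over; this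
  turns \<open>qq i j\<close> into \<open>qc k\<close>.\<close>

lemma third_idx: "i \<noteq> j \<Longrightarrow> \<exists>k. k \<noteq> i \<and> k \<noteq> j \<and> {i, j} = - {k::idx}"
  by (cases i; cases j)
    (auto simp: insert_commute compl_idx[symmetric])

lemma other_idx: "\<exists>k. k \<noteq> i \<and> k \<noteq> (j::idx)"
  by (cases i; cases j) (auto intro: exI[of _ I1] exI[of _ I2] exI[of _ I3])

text \<open>\<open>qc k\<close> is $q^{i,j}$ with \<open>{i, j, k} = I\<close>.\<close>

abbreviation qc :: "idx \<Rightarrow> point"
  where "qc k \<equiv> E (- {k})"

text \<open>Indexing the points \<open>qq i j\<close> by the omitted index removes the ambiguity
  between \<open>i, j\<close> and \<open>j, i\<close>, so each point has exactly one of three forms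
  with unique parameters.\<close>

lemma tp_points_eq: "tp_points = range Q \<union> {V x i |x i. True} \<union> range qc"
proof -
  have "{qq i j |i j. i \<noteq> j} = range qc"
  proof (intro subset_antisym subsetI)
    show "p \<in> range qc" if "p \<in> {qq i j |i j. i \<noteq> j}" for p
      using that third_idx by fastforce
    show "p \<in> {qq i j |i j. i \<noteq> j}" if p: "p \<in> range qc" for p
    proof -
      from p obtain k where "p = qc k" by blast
      then show ?thesis by (cases k) (auto simp: compl_idx)
    qed
  qed
  then show ?thesis by (simp add: tp_points_def)
qed

lemma tp_points_cases [case_names Q V qc]:
  assumes "p \<in> tp_points"
  obtains x where "p = Q x" | x i where "p = V x i" | k where "p = qc k"
  using assms unfolding tp_points_eq by blast

lemma tp_points_simps [simp]: "Q x \<in> tp_points" "V x i \<in> tp_points" "qc k \<in> tp_points"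
  by (auto simp: tp_points_eq)

lemma Compl_singleton_eq_iff: "- {k} = - {l} \<longleftrightarrow> k = l"
  by auto

locale perspectives =
  fixes \<xi> :: "idx \<Rightarrow> idx \<Rightarrow> tri \<Rightarrow> tri"
  assumes datum: "perspective_datum \<xi>"
begin

abbreviation coll :: "point \<Rightarrow> point \<Rightarrow> bool"
  where "coll \<equiv> joined (tp_lines \<xi>)"

lemma xi_Bij: "\<xi> i j \<in> Bij UNIV"
proof -
  have "\<xi> i j \<in> carrier S_tri" using datum unfolding perspective_datum_def by blast
  then show ?thesis by (simp add: BijGroup_def)
qed

lemma bij_xi: "bij (\<xi> i j)"
  using xi_Bij[of i j] by (simp add: Bij_def)

lemma xi_refl: "\<xi> i i = id"
  using datum unfolding perspective_datum_def by blast

lemma xi_swap: "\<xi> j i = inv' (\<xi> i j)"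
proof -
  have "\<xi> j i = inv\<^bsub>S_tri\<^esub> (\<xi> i j)"
    using datum unfolding perspective_datum_def by blast
  also have "\<dots> = inv' (\<xi> i j)" by (simp only: inv_BijGroup[OF xi_Bij] restrict_UNIV)
  finally show ?thesis .
qed

lemma xi_cancel [simp]: "\<xi> j i (\<xi> i j x) = x"
  using bij_xi by (simp add: xi_swap[of j i] bij_is_inj)

section \<open>The collinearity table for the three kinds of points\<close>

lemma coll_sym: "coll p q \<longleftrightarrow> coll q p"
  by (auto simp: joined_def)

lemma coll_QQ: "coll (Q x) (Q y) \<longleftrightarrow> x \<noteq> y"
proof -
  have "\<forall>z. Q z \<in> {Q Ta, Q Tb, Q Tc}" by (simp add: all_tri)
  moreover have "{Q Ta, Q Tb, Q Tc} \<in> tp_lines \<xi>" by (simp add: tp_lines_def)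
  ultimately show ?thesis unfolding joined_def by blast
qed

lemma line_Q: "{Q Ta, Q Tb, Q Tc} \<in> tp_lines \<xi>"
  "{Q Ta, V Tb i, V Tc i} \<in> tp_lines \<xi>"
  "{Q Tb, V Ta i, V Tc i} \<in> tp_lines \<xi>"
  "{Q Tc, V Ta i, V Tb i} \<in> tp_lines \<xi>"
  by (auto simp: tp_lines_def)

text \<open>The three families attached to \<open>Q Ta\<close>, \<open>Q Tb\<close> and
  \<open>Q Tc\<close> become one family symmetric in the labels, so later arguments need no case
  split on them.\<close>

lemma line_Qxy:
  assumes "x \<noteq> y" "y \<noteq> z" "x \<noteq> z"
  shows "{Q x, V y i, V z i} \<in> tp_lines \<xi>"
  using assms line_Q(2-4)[of i] by (cases x; cases y; cases z) (simp_all add: insert_commute)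

lemma line_R: "i \<noteq> j \<Longrightarrow> {qq i j, V x i, V (\<xi> i j x) j} \<in> tp_lines \<xi>"
  "range qc \<in> tp_lines \<xi>"
proof -
  show "{qq i j, V x i, V (\<xi> i j x) j} \<in> tp_lines \<xi>" if "i \<noteq> j"
    unfolding tp_lines_def using that by blast
  have "range qc = {qq I1 I2, qq I1 I3, qq I2 I3}" by (auto simp: UNIV_idx compl_idx)
  then show "range qc \<in> tp_lines \<xi>" by (simp add: tp_lines_def)
qed

lemma tp_lines_cases:
  assumes "l \<in> tp_lines \<xi>"
  obtains (Q) "l = range Q"
  | (QVV) x y z i where "l = {Q x, V y i, V z i}" "x \<noteq> y" "y \<noteq> z" "x \<noteq> z"
  | (EVV) i j x where "l = {qq i j, V x i, V (\<xi> i j x) j}" "i \<noteq> j"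
  | (qc) "l = range qc"
proof -
  have Q: "{Q Ta, Q Tb, Q Tc} = range Q" and qc: "{qq I1 I2, qq I1 I3, qq I2 I3} = range qc"
    by (auto simp: UNIV_idx UNIV_tri compl_idx)
  from assms have "l = range Q \<or> (\<exists>i. l = {Q Ta, V Tb i, V Tc i}) \<or>
      (\<exists>i. l = {Q Tb, V Ta i, V Tc i}) \<or> (\<exists>i. l = {Q Tc, V Ta i, V Tb i}) \<or>
      (\<exists>i j x. l = {qq i j, V x i, V (\<xi> i j x) j} \<and> i \<noteq> j) \<or> l = range qc"
    by (simp only: tp_lines_def Q qc Un_iff mem_Collect_eq singleton_iff simp_thms disj_assoc)
  then show thesis
  proof (elim disjE exE conjE)
    show thesis if "l = {Q Ta, V Tb i, V Tc i}" for i using QVV[of Ta Tb i Tc] that by simp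
    show thesis if "l = {Q Tb, V Ta i, V Tc i}" for i using QVV[of Tb Ta i Tc] that by simp
    show thesis if "l = {Q Tc, V Ta i, V Tb i}" for i using QVV[of Tc Ta i Tb] that by simp
  qed (fact that)+
qed

lemma third_tri: "\<exists>z. z \<noteq> x \<and> z \<noteq> (y::tri)"
  by (cases x; cases y) (auto intro: exI[of _ Ta] exI[of _ Tb] exI[of _ Tc])

lemma coll_QV: "coll (Q x) (V y i) \<longleftrightarrow> x \<noteq> y"
proof
  assume "coll (Q x) (V y i)"
  then show "x \<noteq> y" unfolding joined_def by (auto elim!: tp_lines_cases)
next
  assume "x \<noteq> y"
  moreover obtain z where "z \<noteq> x" "z \<noteq> y" using third_tri by blast
  ultimately show "coll (Q x) (V y i)"
    by (intro joinedI[OF line_Qxy[of x y z i]]) auto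
qed

lemma coll_QR: "\<not> coll (Q x) (E e)"
  unfolding joined_def by (auto elim!: tp_lines_cases)

text \<open>For distinct indices collinearity is the graph of \<open>\<xi> i j\<close>, which is how
  the datum is recovered from the geometry. A line may list its two indices in either order;
  \<open>xi_cancel\<close> reconciles the two readings.\<close>

lemma coll_VV: "coll (V x i) (V y j) \<longleftrightarrow> (if i = j then x \<noteq> y else y = \<xi> i j x)"
proof
  assume "coll (V x i) (V y j)"
  then show "if i = j then x \<noteq> y else y = \<xi> i j x"
    unfolding joined_def by (auto elim!: tp_lines_cases)
next
  assume *: "if i = j then x \<noteq> y else y = \<xi> i j x"
  show "coll (V x i) (V y j)"
  proof (cases "i = j")
    case True
    moreover obtain z where "z \<noteq> x" "z \<noteq> y" using third_tri by blast
    ultimately show ?thesis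
      using * by (intro joinedI[OF line_Qxy[of z x y i]]) auto
  next
    case False
    then show ?thesis using * by (intro joinedI[OF line_R(1)[of i j x]]) auto
  qed
qed

lemma coll_VR: "coll (V x i) (qc k) \<longleftrightarrow> i \<noteq> k"
proof
  assume "coll (V x i) (qc k)"
  then show "i \<noteq> k"
    unfolding joined_def by (auto elim!: tp_lines_cases)
next
  assume "i \<noteq> k"
  then obtain j where j: "j \<noteq> i" "j \<noteq> k" "{i, k} = - {j}"
    using third_idx[OF \<open>i \<noteq> k\<close>] by blast
  then have "- {k} = {i, j}" using \<open>i \<noteq> k\<close> by auto
  then show "coll (V x i) (qc k)" using j by (intro joinedI[OF line_R(1)[of i j x]]) auto
qed

lemma coll_RR: "coll (qc k) (qc l) \<longleftrightarrow> k \<noteq> l"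
proof
  assume "k \<noteq> l"
  then show "coll (qc k) (qc l)" by (intro joinedI[OF line_R(2)]) auto
qed (simp add: joined_def)

text \<open>\<open>coll_sym\<close> is permutative, so the reversed orientations are recorded as
  rewrite rules of their own.\<close>

lemma coll_flip: "coll (V y i) (Q x) \<longleftrightarrow> x \<noteq> y" "\<not> coll (E e) (Q x)" "coll (qc k) (V x i) \<longleftrightarrow> i \<noteq> k"
  by (subst coll_sym, rule coll_QV, subst coll_sym, rule coll_QR, subst coll_sym, rule coll_VR)

lemmas coll_simps = coll_QQ coll_QV coll_QR coll_VV coll_VR coll_RR coll_flip

section \<open>Which points of the configuration are Veblen points\<close>

lemma veblen_R: "veblen_point (tp_lines \<xi>) (qc k)"
  unfolding veblen_point_def
proof (intro allI impI)
  fix p m assume p: "coll (qc k) p" and m: "m \<in> tp_lines \<xi>" "qc k \<in> m"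
  have "p \<in> tp_points" using p Union_tp_lines unfolding joined_def by blast
  from m(1) show "\<exists>y\<in>m. y \<noteq> qc k \<and> (y = p \<or> coll p y)"
  proof (cases rule: tp_lines_cases)
    case (EVV i j x)
    \<comment> \<open>If \<open>p\<close> is a vertex over \<open>i\<close> or \<open>j\<close>, it
      equals or shares a triangle with the vertex of \<open>m\<close> of that index. If
      \<open>p\<close> is another \<open>qc l\<close>, it is collinear with the vertex of
      \<open>m\<close> whose index is not \<open>l\<close>.\<close>
    then have "- {k} = {i, j}" using m(2) by auto
    then have k: "l \<noteq> k \<longleftrightarrow> l = i \<or> l = j" for l by blast
    from \<open>p \<in> tp_points\<close> show ?thesis
    proof (cases rule: tp_points_cases)
      case (V y l)
      then have "l = i \<or> l = j" using p k by (simp add: coll_simps)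
      then show ?thesis using V EVV by (auto simp: coll_simps)
    next
      case (qc l)
      then have "l = i \<or> l = j" using p k[of l] by (auto simp: coll_simps)
      then show ?thesis using qc EVV by (auto simp: coll_simps)
    qed (use p in \<open>simp add: coll_simps\<close>)
  next
    case qc
    from \<open>p \<in> tp_points\<close> show ?thesis
    proof (cases rule: tp_points_cases)
      case (V y l)
      then have "l \<noteq> k" using p by (auto simp: coll_simps)
      \<comment> \<open>Avoiding \<open>k\<close> makes \<open>qc j\<close> differ from
        \<open>qc k\<close>; avoiding \<open>l\<close> makes it collinear with
        \<open>V y l\<close>.\<close>
      then obtain j where "j \<noteq> k" "j \<noteq> l" using other_idx by metis
      then show ?thesis using V qc by (auto simp: coll_simps intro!: bexI[of _ "qc j"])
    next
      case (qc l)
      then show ?thesis using p \<open>m = range qc\<close> by (auto simp: coll_simps)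
    qed (use p in \<open>simp add: coll_simps\<close>)
  qed (use m(2) in auto)
qed

text \<open>If \<open>x\<close> is moved, its preimage \<open>?y\<close> under
  \<open>\<xi> i j\<close> gives a point \<open>V ?y i\<close> collinear with \<open>Q x\<close>
  whose only neighbour over \<open>j\<close> is \<open>V x j\<close>. That vertex is missing from
  the line of \<open>Q x\<close> over \<open>j\<close>, so the Veblen condition fails.\<close>

lemma veblen_Q:
  assumes "veblen_point (tp_lines \<xi>) (Q x)"
  shows "\<xi> i j x = x"
proof (rule ccontr)
  assume *: "\<xi> i j x \<noteq> x"
  then have "i \<noteq> j" using xi_refl by auto
  let ?y = "\<xi> j i x"
  have y: "?y \<noteq> x" using * by (metis xi_cancel)
  then have coll: "coll (Q x) (V ?y i)" by (simp add: coll_simps)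
  obtain u v where uv: "x \<noteq> u" "u \<noteq> v" "x \<noteq> v" using * third_tri by metis
  have "\<exists>p\<in>{Q x, V u j, V v j}. p \<noteq> Q x \<and> (p = V ?y i \<or> coll (V ?y i) p)"
    using assms coll line_Qxy[OF uv] unfolding veblen_point_def by blast
  then show False using uv \<open>i \<noteq> j\<close> by (auto simp: coll_simps)
qed

lemma veblen_V:
  assumes veblen: "veblen_point (tp_lines \<xi>) (V x i)"
  shows "\<xi> j k x = x"
proof -
  have fixed: "\<xi> i j x = x" for j
  proof (rule ccontr)
    assume *: "\<xi> i j x \<noteq> x"
    \<comment> \<open>The point \<open>Q ?y\<close> is collinear neither with \<open>V ?y j\<close>
      nor with \<open>qq i j\<close>, so the line through these two and \<open>V x i\<close>
      violates the condition.\<close>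
    let ?y = "\<xi> i j x"
    have "i \<noteq> j" using * xi_refl by auto
    have "coll (V x i) (Q ?y)" using * by (simp add: coll_simps)
    then have "\<exists>p\<in>{qq i j, V x i, V ?y j}. p \<noteq> V x i \<and> (p = Q ?y \<or> coll (Q ?y) p)"
      using veblen line_R(1)[OF \<open>i \<noteq> j\<close>] unfolding veblen_point_def by blast
    then show False by (auto simp: coll_simps)
  qed
  show ?thesis
  proof (cases "i = j \<or> i = k \<or> j = k")
    case True
    then show ?thesis using fixed xi_refl xi_cancel by (metis id_apply)
  next
    case False
    then have jk: "i \<noteq> j" "i \<noteq> k" "j \<noteq> k" by auto
    then have k: "{i, k} = - {j}" by (cases i; cases j; cases k) (auto simp: compl_idx)
    \<comment> \<open>As the three indices are distinct, \<open>qq i k\<close> is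
      \<open>qc j\<close>, which is not collinear with \<open>V x j\<close>. The condition thus
      forces \<open>V x j\<close> and \<open>V x k\<close> to be collinear, which means
      \<open>\<xi> j k x = x\<close>.\<close>
    have "coll (V x i) (V x j)" using jk fixed by (simp add: coll_simps)
    then have "\<exists>p\<in>{qq i k, V x i, V x k}. p \<noteq> V x i \<and> (p = V x j \<or> coll (V x j) p)"
      using veblen line_R(1)[OF \<open>i \<noteq> k\<close>, of x] fixed[of k] unfolding veblen_point_def by auto
    then show ?thesis using jk k by (auto simp: coll_simps)
  qed
qed

end

section \<open>Automorphisms of systems without a common fixed point\<close>

lemma bij_Compl_image: "bij \<alpha> \<Longrightarrow> \<alpha> ` (- {k}) = - {\<alpha> k}"
  by (simp add: bij_image_Compl_eq)

lemma times_map_R: "bij \<alpha> \<Longrightarrow> times_map \<beta> \<alpha> (qc k) = qc (\<alpha> k)"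
  by (simp add: times_map_def bij_Compl_image)

lemma times_map_inject:
  assumes "times_map \<beta> \<alpha> = times_map \<beta>' \<alpha>'"
  shows "\<beta> = \<beta>'" "\<alpha> = \<alpha>'"
proof -
  have "V (\<beta> x) (\<alpha> i) = V (\<beta>' x) (\<alpha>' i)" for x i
    using assms by (metis times_map_simps(2))
  then show "\<beta> = \<beta>'" "\<alpha> = \<alpha>'" by auto
qed

lemma times_map_compose:
  assumes "bij \<alpha>" "bij \<alpha>'"
  shows "compose tp_points (times_map \<beta> \<alpha>) (times_map \<beta>' \<alpha>') = times_map (\<beta> \<circ> \<beta>') (\<alpha> \<circ> \<alpha>')"
proof
  fix p
  show "compose tp_points (times_map \<beta> \<alpha>) (times_map \<beta>' \<alpha>') p = times_map (\<beta> \<circ> \<beta>') (\<alpha> \<circ> \<alpha>') p"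
  proof (cases "p \<in> tp_points")
    case True
    then show ?thesis
      by (cases rule: tp_points_cases)
        (use assms in \<open>auto simp: compose_def times_map_R times_map_simps bij_comp\<close>)
  next
    case False
    then show ?thesis by (simp add: compose_def times_map_def)
  qed
qed

lemma times_map_Bij:
  assumes "bij \<beta>" "bij \<alpha>"
  shows "times_map \<beta> \<alpha> \<in> Bij tp_points"
proof -
  \<comment> \<open>Stated for arbitrary right inverses, so that it serves both orders of
    composition below.\<close>
  have inv: "compose tp_points (times_map \<beta> \<alpha>) (times_map \<beta>' \<alpha>') = restrict id tp_points"
    if "bij \<alpha>" "bij \<alpha>'" "\<beta> \<circ> \<beta>' = id" "\<alpha> \<circ> \<alpha>' = id" for \<alpha> \<alpha>' \<beta> \<beta>'
    using that by (simp add: times_map_compose)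
      (auto simp: times_map_def fun_eq_iff restrict_def split: point.split)
  have into: "times_map \<beta> \<alpha> \<in> tp_points \<rightarrow> tp_points" if "bij \<alpha>" for \<alpha> \<beta>
    using that by (auto elim!: tp_points_cases simp: times_map_R times_map_simps)
  have "bij_betw (times_map \<beta> \<alpha>) tp_points tp_points"
  proof (rule bij_betwI[OF into into])
    show "bij \<alpha>" "bij (inv' \<alpha>)" using assms by (auto simp: bij_imp_bij_inv)
    show "times_map (inv' \<beta>) (inv' \<alpha>) (times_map \<beta> \<alpha> p) = p" if "p \<in> tp_points" for p
      using inv[of "inv' \<alpha>" \<alpha> "inv' \<beta>" \<beta>] that assms
      by (auto simp: fun_eq_iff compose_def bij_imp_bij_inv bij_is_inj split: if_splits)
    show "times_map \<beta> \<alpha> (times_map (inv' \<beta>) (inv' \<alpha>) p) = p" if "p \<in> tp_points" for p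
      using inv[of \<alpha> "inv' \<alpha>" \<beta> "inv' \<beta>"] that assms
      by (auto simp: fun_eq_iff compose_def bij_imp_bij_inv bij_is_surj surj_f_inv_f
          split: if_splits)
  qed
  then show ?thesis by (simp add: Bij_def times_map_def)
qed

context perspectives
begin

text \<open>It suffices that lines go to lines: the line set is finite and the induced map on it is
  injective, hence onto.\<close>

lemma times_map_automorphism:
  assumes "bij \<beta>" "bij \<alpha>" and comm: "\<And>i j. \<xi> (\<alpha> i) (\<alpha> j) \<circ> \<beta> = \<beta> \<circ> \<xi> i j"
  shows "times_map \<beta> \<alpha> \<in> carrier (tp_aut_group \<xi>)"
proof -
  have inj: "inj \<beta>" "inj \<alpha>" using assms by (auto simp: bij_is_inj)
  have sub: "image (times_map \<beta> \<alpha>) ` tp_lines \<xi> \<subseteq> tp_lines \<xi>"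
  proof (rule image_subsetI)
    fix l assume "l \<in> tp_lines \<xi>"
    then show "times_map \<beta> \<alpha> ` l \<in> tp_lines \<xi>"
    proof (cases rule: tp_lines_cases)
      case Q
      then have "times_map \<beta> \<alpha> ` l = range Q"
        using bij_is_surj[OF \<open>bij \<beta>\<close>] by (auto simp: image_image times_map_simps)
      then show ?thesis using line_Q(1) by (simp add: UNIV_tri)
    next
      case (QVV x y z i)
      then show ?thesis using line_Qxy inj by (simp add: times_map_simps inj_eq)
    next
      case (EVV i j x)
      have "\<alpha> i \<noteq> \<alpha> j" using EVV inj by (auto dest: injD)
      moreover have "\<xi> (\<alpha> i) (\<alpha> j) (\<beta> x) = \<beta> (\<xi> i j x)" using comm by (metis comp_apply)
      ultimately show ?thesis using EVV line_R(1)[of "\<alpha> i" "\<alpha> j" "\<beta> x"]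
        by (simp add: times_map_simps)
    next
      case qc
      then have "times_map \<beta> \<alpha> ` l = range (\<lambda>k. qc (\<alpha> k))"
        using assms by (auto simp: image_image times_map_R)
      also have "\<dots> = range qc" using bij_is_surj[OF \<open>bij \<alpha>\<close>] by (auto simp: image_iff)
      finally show ?thesis using line_R(2) by simp
    qed
  qed
  have bij: "times_map \<beta> \<alpha> \<in> Bij tp_points" using assms by (rule_tac times_map_Bij)
  have "finite tp_points"
    using finite_subset[of "{V x i |x i. True}" "case_prod V ` UNIV"]
    by (auto simp: tp_points_eq)
  then have "finite (tp_lines \<xi>)"
    using Union_tp_lines by (metis finite_UnionD finite_subset)
  moreover have "inj_on (image (times_map \<beta> \<alpha>)) (tp_lines \<xi>)"
    using bij inj_on_subset[OF inj_on_image_Pow[of "times_map \<beta> \<alpha>" tp_points]] Union_tp_lines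
    by (auto simp: Bij_def bij_betw_def)
  ultimately have "image (times_map \<beta> \<alpha>) ` tp_lines \<xi> = tp_lines \<xi>"
    using sub by (rule_tac endo_inj_surj)
  with bij show ?thesis by (simp add: tp_aut_group_def incidence_automorphism_group_def)
qed

lemma automorphism_times_map:
  assumes f: "f \<in> carrier (tp_aut_group \<xi>)" and no_fix: "\<And>x. \<exists>i j. \<xi> i j x \<noteq> x"
  obtains \<alpha> \<beta> where "bij \<alpha>" "bij \<beta>" "f = times_map \<beta> \<alpha>"
    "\<And>i j. \<xi> (\<alpha> i) (\<alpha> j) \<circ> \<beta> = \<beta> \<circ> \<xi> i j"
proof -
  note f = f[unfolded tp_aut_group_def]
  note fD = incidence_automorphismD[OF f]
  have coll_f: "coll (f p) (f q) \<longleftrightarrow> coll p q" if "p \<in> tp_points" "q \<in> tp_points" for p q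
    using joined_automorphism[OF f Union_tp_lines that] .
  have f_in: "f p \<in> tp_points" if "p \<in> tp_points" for p using fD(3) that by blast
  have f_eq: "f p = f q \<longleftrightarrow> p = q" if "p \<in> tp_points" "q \<in> tp_points" for p q
    using fD(2) that by (auto dest: inj_onD)
  \<comment> \<open>The image is a Veblen point; if it were some \<open>Q x\<close> or
    \<open>V x i\<close>, the label \<open>x\<close> would be fixed by the whole datum.\<close>
  have "\<exists>l. f (qc k) = qc l" for k
    using f_in[of "qc k"] veblen_point_automorphism[OF f Union_tp_lines _ veblen_R, of k]
      veblen_Q veblen_V no_fix by (auto elim!: tp_points_cases) blast+
  then obtain \<alpha> where \<alpha>: "\<And>k. f (qc k) = qc (\<alpha> k)" by metis
  have "inj \<alpha>" using \<alpha> f_eq by (metis injI Compl_singleton_eq_iff point.inject(3) tp_points_simps(3))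
  then have "bij \<alpha>" by (simp add: bij_def finite_UNIV_inj_surj)
  have R_surj: "\<exists>l. qc k = f (qc l)" for k
    using \<alpha> bij_is_surj[OF \<open>bij \<alpha>\<close>] by (metis surjD)
  \<comment> \<open>Every \<open>qc k\<close> is an image, so \<open>f (Q x)\<close> is collinear
    with none of them. This excludes a vertex \<open>V y i\<close>, which is collinear with
    \<open>qc k\<close> for each \<open>k \<noteq> i\<close>.\<close>
  have "\<exists>y. f (Q x) = Q y" for x
  proof -
    have "\<not> coll (f (Q x)) (qc k)" for k
      using R_surj[of k] coll_f by (auto simp: coll_simps)
    moreover have "f (Q x) \<noteq> qc k" for k
      using R_surj[of k] f_eq by auto
    moreover have "f (Q x) \<in> tp_points" using f_in by simp
    ultimately show ?thesis
      using other_idx by (auto elim!: tp_points_cases simp: coll_simps) metis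
  qed
  then obtain \<beta> where \<beta>: "\<And>x. f (Q x) = Q (\<beta> x)" by metis
  have "inj \<beta>" using \<beta> f_eq by (metis injI point.inject(1) tp_points_simps(1))
  then have "bij \<beta>" by (simp add: bij_def finite_UNIV_inj_surj)
  have fV: "f (V x i) = V (\<beta> x) (\<alpha> i)" for x i
  proof -
    \<comment> \<open>Among the points \<open>Q y\<close> and among the points \<open>qc k\<close>,
      a vertex fails to be collinear with exactly one each, and these two determine it.\<close>
    have Q: "coll (f (V x i)) (Q (\<beta> y)) \<longleftrightarrow> y \<noteq> x" for y
      using coll_f[of "V x i" "Q y"] \<beta> by (auto simp: coll_simps)
    have qc: "coll (f (V x i)) (qc (\<alpha> k)) \<longleftrightarrow> k \<noteq> i" for k
      using coll_f[of "V x i" "qc k"] \<alpha> by (auto simp: coll_simps)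
    obtain y where "y \<noteq> x" using third_tri by blast
    obtain k where "k \<noteq> i" using other_idx by metis
    from f_in[of "V x i", simplified] show ?thesis
    proof (cases rule: tp_points_cases)
      case (Q z)
      then show ?thesis using qc[of k] \<open>k \<noteq> i\<close> by (simp add: coll_simps)
    next
      case (V z l)
      then show ?thesis using Q[of x] qc[of i] by (simp add: coll_simps)
    next
      case (qc l)
      then show ?thesis using Q[of y] \<open>y \<noteq> x\<close> by (simp add: coll_simps)
    qed
  qed
  have "f = times_map \<beta> \<alpha>"
  proof
    fix p
    show "f p = times_map \<beta> \<alpha> p"
    proof (cases "p \<in> tp_points")
      case True
      then show ?thesis
        by (cases rule: tp_points_cases)
          (simp_all add: \<alpha> \<beta> fV times_map_simps times_map_R \<open>bij \<alpha>\<close>)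
    next
      case False
      then show ?thesis using fD(1) by (simp add: Bij_def times_map_def extensional_def)
    qed
  qed
  \<comment> \<open>Collinearity of vertices over distinct indices is the graph of the datum, so
    preserving it amounts to the intertwining relation.\<close>
  moreover have "\<xi> (\<alpha> i) (\<alpha> j) \<circ> \<beta> = \<beta> \<circ> \<xi> i j" for i j
  proof (cases "i = j")
    case False
    then have "\<alpha> i \<noteq> \<alpha> j" using \<open>inj \<alpha>\<close> by (auto dest: injD)
    then show ?thesis using coll_f[of "V x i" "V (\<xi> i j x) j" for x] False
      by (simp add: fun_eq_iff coll_simps fV)
  qed (simp add: xi_refl)
  ultimately show ?thesis using that \<open>bij \<alpha>\<close> \<open>bij \<beta>\<close> by blast
qed

lemma carrier_tp_aut_group:
  assumes "\<And>x. \<exists>i j. \<xi> i j x \<noteq> x"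
  shows "carrier (tp_aut_group \<xi>) =
    {times_map \<beta> \<alpha> |\<alpha> \<beta>. bij \<alpha> \<and> bij \<beta> \<and> (\<forall>i j. \<xi> (\<alpha> i) (\<alpha> j) \<circ> \<beta> = \<beta> \<circ> \<xi> i j)}"
  using times_map_automorphism automorphism_times_map[OF _ assms] by blast

end

section \<open>Permutations of three objects\<close>

lemma carrier_S: "carrier (BijGroup UNIV) = {f. bij f}"
  by (auto simp: BijGroup_def Bij_def)

lemma mult_S: "bij f \<Longrightarrow> bij g \<Longrightarrow> f \<otimes>\<^bsub>BijGroup UNIV\<^esub> g = f \<circ> g"
  by (auto simp: BijGroup_def Bij_def compose_def)

lemma one_S: "\<one>\<^bsub>BijGroup UNIV\<^esub> = id"
  by (auto simp: BijGroup_def)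

lemma inv_S: "bij f \<Longrightarrow> inv\<^bsub>BijGroup UNIV\<^esub> f = inv' f"
  by (simp add: inv_BijGroup Bij_def restrict_UNIV)

lemma fun_eq_tri: "f = g \<longleftrightarrow> f Ta = g Ta \<and> f Tb = g Tb \<and> f Tc = g Tc"
  by (simp add: fun_eq_iff all_tri)

lemma fun_eq_idx: "f = g \<longleftrightarrow> f I1 = g I1 \<and> f I2 = g I2 \<and> f I3 = g I3"
  by (simp add: fun_eq_iff all_idx)

lemma ex_tri: "(\<exists>x. P x) \<longleftrightarrow> P Ta \<or> P Tb \<or> P Tc"
  by (metis tri.exhaust)

lemma ex_idx: "(\<exists>i. P i) \<longleftrightarrow> P I1 \<or> P I2 \<or> P I3"
  by (metis idx.exhaust)

text \<open>These values replace the defining transpositions as rewrite rules, so equations between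
  permutations reduce to evaluation at three arguments.\<close>

lemma sigma_table:
  "sigma Ta Ta = Ta" "sigma Ta Tb = Tc" "sigma Ta Tc = Tb"
  "sigma Tb Ta = Tc" "sigma Tb Tb = Tb" "sigma Tb Tc = Ta"
  "sigma Tc Ta = Tb" "sigma Tc Tb = Ta" "sigma Tc Tc = Tc"
  by (simp_all add: transpose_def)

lemma sigma_idx_table:
  "sigma_idx I1 I1 = I1" "sigma_idx I1 I2 = I3" "sigma_idx I1 I3 = I2"
  "sigma_idx I2 I1 = I3" "sigma_idx I2 I2 = I2" "sigma_idx I2 I3 = I1"
  "sigma_idx I3 I1 = I2" "sigma_idx I3 I2 = I1" "sigma_idx I3 I3 = I3"
  by (simp_all add: transpose_def)

declare sigma.simps [simp del] sigma_idx.simps [simp del]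
  sigma_table [simp] sigma_idx_table [simp]

lemma rho_rho_rho: "rho \<circ> rho \<circ> rho = id"
  by (simp add: fun_eq_tri)

lemma varrho_varrho_varrho: "varrho \<circ> varrho \<circ> varrho = id"
  by (simp add: fun_eq_idx)

lemma sigma_sigma: "sigma x \<circ> sigma x = id"
  by (cases x) (simp_all add: fun_eq_tri)

lemma sigma_idx_sigma_idx: "sigma_idx i \<circ> sigma_idx i = id"
  by (cases i) (simp_all add: fun_eq_idx)

section \<open>The two symmetric groups listed element by element\<close>

abbreviation perms_tri :: "(tri \<Rightarrow> tri) set"
  where "perms_tri \<equiv> {id, rho, rho \<circ> rho, sigma Ta, sigma Tb, sigma Tc}"

abbreviation perms_idx :: "(idx \<Rightarrow> idx) set"
  where "perms_idx \<equiv> {id, varrho, varrho \<circ> varrho, sigma_idx I1, sigma_idx I2, sigma_idx I3}"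

text \<open>Of the 27 value tables on three labels, distinctness of the values leaves the six listed
  ones. This turns quantification over bijections into a finite check.\<close>

lemma bij_tri_iff: "bij \<beta> \<longleftrightarrow> \<beta> \<in> perms_tri"
proof
  assume "bij \<beta>"
  then have "\<beta> Ta \<noteq> \<beta> Tb" "\<beta> Ta \<noteq> \<beta> Tc" "\<beta> Tb \<noteq> \<beta> Tc"
    by (auto simp: bij_is_inj inj_eq)
  then show "\<beta> \<in> perms_tri"
    by (cases "\<beta> Ta"; cases "\<beta> Tb"; cases "\<beta> Tc") (simp_all add: fun_eq_tri)
next
  have "bij rho"
    using rho_rho_rho by (metis comp_assoc o_bij)
  moreover have "bij (sigma x)" for x
    using sigma_sigma by (metis o_bij)
  moreover assume "\<beta> \<in> perms_tri"
  ultimately show "bij \<beta>" by (auto intro: bij_comp)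
qed

lemma bij_idx_iff: "bij \<alpha> \<longleftrightarrow> \<alpha> \<in> perms_idx"
proof
  assume "bij \<alpha>"
  then have "\<alpha> I1 \<noteq> \<alpha> I2" "\<alpha> I1 \<noteq> \<alpha> I3" "\<alpha> I2 \<noteq> \<alpha> I3"
    by (auto simp: bij_is_inj inj_eq)
  then show "\<alpha> \<in> perms_idx"
    by (cases "\<alpha> I1"; cases "\<alpha> I2"; cases "\<alpha> I3") (simp_all add: fun_eq_idx)
next
  have "bij varrho"
    using varrho_varrho_varrho by (metis comp_assoc o_bij)
  moreover have "bij (sigma_idx i)" for i
    using sigma_idx_sigma_idx by (metis o_bij)
  moreover assume "\<alpha> \<in> perms_idx"
  ultimately show "bij \<alpha>" by (auto intro: bij_comp)
qed

lemma bij_perm [simp]: "bij rho" "bij (sigma x)" "bij varrho" "bij (sigma_idx i)"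
  using bij_tri_iff bij_idx_iff by (cases x; cases i; blast)+

lemma inv_rho: "inv' rho = rho \<circ> rho"
  using rho_rho_rho by (metis inv_unique_comp comp_assoc)

lemma inv_sigma: "inv' (sigma x) = sigma x"
  using sigma_sigma by (metis inv_unique_comp)

text \<open>The inverse of \<open>x\<close> is its square, so the three listed elements are closed
  under products and contain the inverse of the generator.\<close>

lemma order_three_generate:
  assumes "group G" "x \<in> carrier G" "x \<otimes>\<^bsub>G\<^esub> x \<otimes>\<^bsub>G\<^esub> x = \<one>\<^bsub>G\<^esub>"
  shows "generate G {x} = {\<one>\<^bsub>G\<^esub>, x, x \<otimes>\<^bsub>G\<^esub> x}"
proof -
  interpret group G by fact
  have assoc: "x \<otimes>\<^bsub>G\<^esub> (x \<otimes>\<^bsub>G\<^esub> x) = \<one>\<^bsub>G\<^esub>" using assms by (simp add: m_assoc)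
  have inv: "inv\<^bsub>G\<^esub> x = x \<otimes>\<^bsub>G\<^esub> x"
    using assms by (intro inv_equality) auto
  show ?thesis
  proof (intro subset_antisym subsetI)
    fix y assume "y \<in> generate G {x}"
    then show "y \<in> {\<one>\<^bsub>G\<^esub>, x, x \<otimes>\<^bsub>G\<^esub> x}"
    proof induction
      case (eng y z)
      have "x \<otimes>\<^bsub>G\<^esub> x \<otimes>\<^bsub>G\<^esub> (x \<otimes>\<^bsub>G\<^esub> x) = x"
        using assms by (simp add: m_assoc assoc)
      with eng show ?case using assms by (auto simp: assoc)
    qed (auto simp: inv)
  next
    fix y assume "y \<in> {\<one>\<^bsub>G\<^esub>, x, x \<otimes>\<^bsub>G\<^esub> x}"
    then show "y \<in> generate G {x}" by (auto intro: generate.intros)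
  qed
qed

lemma inv_rho_rho: "inv' (rho \<circ> rho) = rho"
  using rho_rho_rho by (metis inv_unique_comp comp_assoc)

lemma P_rho_eq: "P_rho = {id, rho, rho \<circ> rho}"
  unfolding P_rho_def
  by (subst order_three_generate[OF group_BijGroup])
    (auto simp: carrier_S mult_S one_S bij_comp rho_rho_rho)

lemma R_varrho_eq: "R_varrho = {id, varrho, varrho \<circ> varrho}"
  unfolding R_varrho_def
  by (subst order_three_generate[OF group_BijGroup])
    (auto simp: carrier_S mult_S one_S bij_comp varrho_varrho_varrho)

section \<open>Homomorphisms out of cyclic and dihedral groups\<close>

text \<open>Powers of \<open>r\<close> indexed by the representatives 0, 1, 2 of
  \<open>integer_mod_group 3\<close>. Every other integer falls into the branch
  \<open>r \<circ> r\<close>, so \<open>bij_rot3\<close> holds for all \<open>k\<close>.\<close>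

definition rot3 :: "('a \<Rightarrow> 'a) \<Rightarrow> int \<Rightarrow> 'a \<Rightarrow> 'a"
  where "rot3 r k = (if k = 0 then id else if k = 1 then r else r \<circ> r)"

definition flip2 :: "('a \<Rightarrow> 'a) \<Rightarrow> int \<Rightarrow> 'a \<Rightarrow> 'a"
  where "flip2 s h = (if h = 0 then id else s)"

lemma carrier_Z2: "carrier (integer_mod_group 2) = {0, 1}"
  by (auto simp: carrier_integer_mod_group)

lemma carrier_Z3: "carrier (integer_mod_group 3) = {0, 1, 2}"
  by (auto simp: carrier_integer_mod_group)

lemma carrier_cyclic_semidirect: "carrier (cyclic_semidirect N) = {0, 1} \<times> carrier N"
  by (simp add: semidirect_def carrier_Z2)

lemma bij_rot3: "r \<circ> r \<circ> r = id \<Longrightarrow> bij (rot3 r k)"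
proof -
  assume r: "r \<circ> r \<circ> r = id"
  then have "bij r" by (metis comp_assoc o_bij)
  then show ?thesis by (simp add: rot3_def bij_comp)
qed

lemma bij_flip2: "s \<circ> s = id \<Longrightarrow> bij (flip2 s h)"
  by (auto simp: flip2_def intro: o_bij)

lemma flip2_hom:
  assumes "s \<circ> s = id"
  shows "flip2 s \<in> hom (integer_mod_group 2) (BijGroup UNIV)"
proof -
  have "bij s" using assms by (auto intro: o_bij)
  then show ?thesis
    using assms by (auto intro!: homI simp: carrier_S mult_S carrier_Z2 flip2_def)
qed

lemma rot3_hom:
  assumes "r \<circ> r \<circ> r = id"
  shows "rot3 r \<in> hom (integer_mod_group 3) (BijGroup UNIV)"
proof -
  have "r (r (r x)) = x" for x using assms by (metis comp_apply id_apply)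
  then show ?thesis
    using assms by (auto intro!: homI simp: carrier_S mult_S bij_rot3 carrier_Z3)
      (auto simp: rot3_def fun_eq_iff)
qed

text \<open>The relation \<open>s r = r\<^sup>2 s\<close> says that \<open>s\<close> inverts \<open>r\<close>; the choice \<open>r = id\<close> is allowed.\<close>

lemma dihedral_hom:
  assumes "comm_group N" and f: "f \<in> hom N (integer_mod_group 3)"
    and rel: "r \<circ> r \<circ> r = id" "s \<circ> s = id" "s \<circ> r = r \<circ> r \<circ> s"
  shows "(\<lambda>(h, n). rot3 r (f n) \<circ> flip2 s h) \<in> hom (cyclic_semidirect N) (BijGroup UNIV)"
proof (rule homI)
  interpret N: comm_group N by fact
  have red: "r (r (r x)) = x" "s (s x) = x" "s (r x) = r (r (s x))" for x
    using rel by (metis comp_apply id_apply)+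
  have f_in: "f n \<in> {0, 1, 2}" if "n \<in> carrier N" for n
    using hom_in_carrier[OF f that] by (simp add: carrier_Z3)
  \<comment> \<open>Later \<open>f\<close> is the identity when \<open>N\<close> is cyclic of order
    three and a coordinate projection when \<open>N\<close> is a product of two such groups. As a
    homomorphism it carries inversion in \<open>N\<close> to negation modulo 3.\<close>
  have f_inv: "f (inv\<^bsub>N\<^esub> n) = - f n mod 3" if "n \<in> carrier N" for n
  proof -
    interpret group_hom N "integer_mod_group 3" f
      using f by (simp add: group_hom_def group_hom_axioms_def)
    show ?thesis using that by simp
  qed
  have f_mult: "f (m \<otimes>\<^bsub>N\<^esub> n) = (f m + f n) mod 3" if "m \<in> carrier N" "n \<in> carrier N" for m n
    using hom_mult[OF f that] by simp
  have bij: "bij (rot3 r k \<circ> flip2 s h)" for h k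
    using rel by (intro bij_comp bij_rot3 bij_flip2)
  then show "(\<lambda>(h, n). rot3 r (f n) \<circ> flip2 s h) x \<in> carrier (BijGroup UNIV)" for x
    by (simp add: carrier_S split_beta)
  fix x y assume "x \<in> carrier (cyclic_semidirect N)" "y \<in> carrier (cyclic_semidirect N)"
  then obtain h m k n where x: "x = (h, m)" "h = 0 \<or> h = 1" "m \<in> carrier N"
    and y: "y = (k, n)" "k = 0 \<or> k = 1" "n \<in> carrier N"
    by (auto simp: carrier_cyclic_semidirect)
  \<comment> \<open>Two flip exponents and two rotation exponents leave 36 instances;
    \<open>red\<close> normalises each word by moving \<open>s\<close> to the right of
    \<open>r\<close>.\<close>
  have "rot3 r ((f m + (if h = 0 then f n else - f n mod 3)) mod 3) \<circ> flip2 s ((h + k) mod 2) =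
      rot3 r (f m) \<circ> flip2 s h \<circ> (rot3 r (f n) \<circ> flip2 s k)"
    using x(2) y(2) f_in[OF x(3)] f_in[OF y(3)]
    by (elim disjE insertE emptyE) (simp_all add: rot3_def flip2_def fun_eq_iff red)
  then show "(\<lambda>(h, n). rot3 r (f n) \<circ> flip2 s h) (x \<otimes>\<^bsub>cyclic_semidirect N\<^esub> y) =
      (\<lambda>(h, n). rot3 r (f n) \<circ> flip2 s h) x \<otimes>\<^bsub>BijGroup UNIV\<^esub> (\<lambda>(h, n). rot3 r (f n) \<circ> flip2 s h) y"
    using x y by (auto simp: mult_S bij semidirect_def inversion_action_def f_mult f_inv)
qed

section \<open>The automorphism groups as subgroups of a direct product\<close>

lemma group_S_prod: "group (S_tri \<times>\<times> S_idx)"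
  by (intro DirProd_group group_BijGroup)

text \<open>The datum is rebuilt from its three values above the diagonal. Being given by equations
  on constructors, it can be evaluated by rewriting once a concrete permutation has been applied to
  the indices.\<close>

fun datum_of :: "(tri \<Rightarrow> tri) \<Rightarrow> (tri \<Rightarrow> tri) \<Rightarrow> (tri \<Rightarrow> tri) \<Rightarrow> idx \<Rightarrow> idx \<Rightarrow> tri \<Rightarrow> tri" where
  "datum_of f g h I1 I2 = f"
| "datum_of f g h I2 I1 = inv' f"
| "datum_of f g h I2 I3 = g"
| "datum_of f g h I3 I2 = inv' g"
| "datum_of f g h I1 I3 = h"
| "datum_of f g h I3 I1 = inv' h"
| "datum_of f g h I1 I1 = id"
| "datum_of f g h I2 I2 = id"
| "datum_of f g h I3 I3 = id"

context perspectives
begin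

lemma xi_eq_datum_of: "\<xi> = datum_of (\<xi> I1 I2) (\<xi> I2 I3) (\<xi> I1 I3)"
proof -
  have "\<xi> i j = datum_of (\<xi> I1 I2) (\<xi> I2 I3) (\<xi> I1 I3) i j" for i j
    by (cases i; cases j)
      (simp_all add: xi_refl xi_swap[of I2 I1] xi_swap[of I3 I2] xi_swap[of I3 I1])
  then show ?thesis by blast
qed

text \<open>Inverting the relation for \<open>i, j\<close> yields the one for \<open>j, i\<close>,
  and the diagonal is trivial, so three relations suffice. With both symmetric groups enumerated,
  the premise on \<open>D\<close> is a check of 36 pairs.\<close>

lemma carrier_tp_aut_groupI:
  assumes x: "\<xi> I1 I2 = f" "\<xi> I2 I3 = g" "\<xi> I1 I3 = h"
    and no_fix: "\<forall>x. f x \<noteq> x \<or> g x \<noteq> x \<or> h x \<noteq> x"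
    and D: "\<forall>\<alpha>\<in>perms_idx. \<forall>\<beta>\<in>perms_tri.
      datum_of f g h (\<alpha> I1) (\<alpha> I2) \<circ> \<beta> = \<beta> \<circ> f \<and> datum_of f g h (\<alpha> I2) (\<alpha> I3) \<circ> \<beta> = \<beta> \<circ> g \<and>
      datum_of f g h (\<alpha> I1) (\<alpha> I3) \<circ> \<beta> = \<beta> \<circ> h \<longleftrightarrow> D \<alpha> \<beta>"
  shows "carrier (tp_aut_group \<xi>) =
    {times_map \<beta> \<alpha> |\<alpha> \<beta>. \<alpha> \<in> carrier S_idx \<and> \<beta> \<in> carrier S_tri \<and> D \<alpha> \<beta>}"
proof -
  have swap: "\<xi> (\<alpha> j) (\<alpha> i) \<circ> \<beta> = \<beta> \<circ> \<xi> j i" if "\<xi> (\<alpha> i) (\<alpha> j) \<circ> \<beta> = \<beta> \<circ> \<xi> i j" for i j \<alpha> \<beta>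
  proof
    fix x
    have "\<beta> x = \<xi> (\<alpha> i) (\<alpha> j) (\<beta> (\<xi> j i x))" using that by (metis comp_apply xi_cancel)
    then show "(\<xi> (\<alpha> j) (\<alpha> i) \<circ> \<beta>) x = (\<beta> \<circ> \<xi> j i) x" by (metis comp_apply xi_cancel)
  qed
  have *: "(\<forall>i j. \<xi> (\<alpha> i) (\<alpha> j) \<circ> \<beta> = \<beta> \<circ> \<xi> i j) \<longleftrightarrow> D \<alpha> \<beta>" if "bij \<alpha>" "bij \<beta>" for \<alpha> \<beta>
  proof -
    have "D \<alpha> \<beta> \<longleftrightarrow> \<xi> (\<alpha> I1) (\<alpha> I2) \<circ> \<beta> = \<beta> \<circ> \<xi> I1 I2 \<and> \<xi> (\<alpha> I2) (\<alpha> I3) \<circ> \<beta> = \<beta> \<circ> \<xi> I2 I3 \<and>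
      \<xi> (\<alpha> I1) (\<alpha> I3) \<circ> \<beta> = \<beta> \<circ> \<xi> I1 I3"
      using D that unfolding bij_tri_iff bij_idx_iff xi_eq_datum_of[unfolded x, symmetric] x by blast
    then show ?thesis
      using swap[of \<alpha> I1 I2 \<beta>] swap[of \<alpha> I2 I3 \<beta>] swap[of \<alpha> I1 I3 \<beta>]
      by (auto simp: all_idx xi_refl)
  qed
  have "\<exists>i j. \<xi> i j x \<noteq> x" for x using no_fix x by blast
  then have "carrier (tp_aut_group \<xi>) =
    {times_map \<beta> \<alpha> |\<alpha> \<beta>. bij \<alpha> \<and> bij \<beta> \<and> (\<forall>i j. \<xi> (\<alpha> i) (\<alpha> j) \<circ> \<beta> = \<beta> \<circ> \<xi> i j)}"
    by (rule carrier_tp_aut_group)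
  also have "\<dots> = {times_map \<beta> \<alpha> |\<alpha> \<beta>. bij \<alpha> \<and> bij \<beta> \<and> D \<alpha> \<beta>}"
    using * by (metis (no_types, opaque_lifting))
  finally show ?thesis by (simp add: carrier_S)
qed

text \<open>\<open>times_map\<close> is injective and multiplicative in the pair, so the
  automorphism group is a copy of a subgroup of the direct product. An embedding
  \<open>\<psi>\<close> of \<open>H\<close> onto that subgroup, followed by
  \<open>times_map\<close>, is an isomorphism.\<close>

lemma tp_aut_group_iso:
  assumes carrier: "carrier (tp_aut_group \<xi>) =
      {times_map \<beta> \<alpha> |\<alpha> \<beta>. \<alpha> \<in> carrier S_idx \<and> \<beta> \<in> carrier S_tri \<and> D \<alpha> \<beta>}"
    and "group H" and hom: "\<psi> \<in> hom H (S_tri \<times>\<times> S_idx)"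
    and ker: "\<forall>h\<in>carrier H. \<psi> h = (id, id) \<longrightarrow> h = \<one>\<^bsub>H\<^esub>"
    and img: "\<forall>\<alpha>\<in>perms_idx. \<forall>\<beta>\<in>perms_tri. D \<alpha> \<beta> \<longleftrightarrow> (\<beta>, \<alpha>) \<in> \<psi> ` carrier H"
  shows "tp_aut_group \<xi> \<cong> H"
proof -
  interpret \<psi>: group_hom H "S_tri \<times>\<times> S_idx" \<psi>
    using hom \<open>group H\<close> group_S_prod by (simp add: group_hom_def group_hom_axioms_def)
  have inj: "inj_on \<psi> (carrier H)"
    using ker unfolding \<psi>.inj_on_one_iff by (simp add: one_S)
  have D: "D \<alpha> \<beta> \<longleftrightarrow> (\<beta>, \<alpha>) \<in> \<psi> ` carrier H" if "bij \<alpha>" "bij \<beta>" for \<alpha> \<beta>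
    using img that unfolding bij_tri_iff bij_idx_iff by blast
  let ?T = "case_prod times_map"
  have bij: "bij \<beta>" "bij \<alpha>" if "(\<beta>, \<alpha>) = \<psi> h" "h \<in> carrier H" for \<alpha> \<beta> h
    using hom_in_carrier[OF hom that(2)] that(1) by (auto simp: carrier_S)
  have img: "(?T \<circ> \<psi>) ` carrier H = carrier (tp_aut_group \<xi>)"
  proof (intro subset_antisym subsetI)
    fix f assume "f \<in> (?T \<circ> \<psi>) ` carrier H"
    then obtain h where h: "h \<in> carrier H" "f = ?T (\<psi> h)" by auto
    obtain \<beta> \<alpha> where \<psi>: "(\<beta>, \<alpha>) = \<psi> h" by (metis surj_pair)
    have "f = times_map \<beta> \<alpha>" by (simp add: h(2) flip: \<psi>)
    with bij[OF \<psi> h(1)] D h \<psi> show "f \<in> carrier (tp_aut_group \<xi>)"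
      unfolding carrier carrier_S by blast
  next
    fix f assume "f \<in> carrier (tp_aut_group \<xi>)"
    then obtain \<alpha> \<beta> where "bij \<alpha>" "bij \<beta>" "D \<alpha> \<beta>" and f: "f = times_map \<beta> \<alpha>"
      unfolding carrier carrier_S by blast
    with D obtain h where h: "h \<in> carrier H" "(\<beta>, \<alpha>) = \<psi> h" by blast
    then have "f = (?T \<circ> \<psi>) h" by (simp add: f flip: h(2))
    with h(1) show "f \<in> (?T \<circ> \<psi>) ` carrier H" by blast
  qed
  have inj: "inj_on (?T \<circ> \<psi>) (carrier H)"
    using inj
  proof (rule comp_inj_on)
    show "inj_on ?T (\<psi> ` carrier H)"
      by (rule inj_onI) (metis case_prod_conv surj_pair times_map_inject)
  qed
  have "?T \<circ> \<psi> \<in> hom H (tp_aut_group \<xi>)"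
  proof (rule homI)
    show "(?T \<circ> \<psi>) x \<in> carrier (tp_aut_group \<xi>)" if "x \<in> carrier H" for x
      using img that by blast
    fix x y assume xy: "x \<in> carrier H" "y \<in> carrier H"
    obtain \<beta> \<alpha> where x: "(\<beta>, \<alpha>) = \<psi> x" by (metis surj_pair)
    obtain \<beta>' \<alpha>' where y: "(\<beta>', \<alpha>') = \<psi> y" by (metis surj_pair)
    note b = bij[OF x xy(1)] bij[OF y xy(2)]
    have "\<psi> (x \<otimes>\<^bsub>H\<^esub> y) = (\<beta> \<circ> \<beta>', \<alpha> \<circ> \<alpha>')"
      using hom_mult[OF hom xy] b by (simp add: mult_S flip: x y)
    then show "(?T \<circ> \<psi>) (x \<otimes>\<^bsub>H\<^esub> y) = (?T \<circ> \<psi>) x \<otimes>\<^bsub>tp_aut_group \<xi>\<^esub> (?T \<circ> \<psi>) y"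
      using b times_map_Bij
      by (simp add: tp_aut_group_def incidence_automorphism_group_def BijGroup_def
          times_map_compose flip: x y)
  qed
  then have "H \<cong> tp_aut_group \<xi>"
    using inj img unfolding is_iso_def iso_def bij_betw_def by blast
  then show ?thesis using group.iso_sym[OF \<open>group H\<close>] by blast
qed

end

section \<open>The abstract groups used for comparison\<close>

lemma group_cyclic_semidirect: "comm_group N \<Longrightarrow> group (cyclic_semidirect N)"
  by (intro group_semidirect inversion_action_hom) (simp_all add: comm_group_def)

text \<open>Numbering the labels conjugates permutations of \<open>tri\<close> into permutations of
  1, 2, 3. This is an injective homomorphism between groups of six elements, hence onto.\<close>

lemma S_tri_iso_sym_group: "S_tri \<cong> sym_group 3"
proof -
  define n where "n x = (case x of Ta \<Rightarrow> 1 | Tb \<Rightarrow> 2 | Tc \<Rightarrow> (3::nat))" for x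
  \<comment> \<open>Elements of \<open>sym_group 3\<close> are functions on all naturals that fix
    everything outside 1 to 3, hence the extension by the identity.\<close>
  define \<Phi> where "\<Phi> \<beta> k = (if k \<in> {1..3} then n (\<beta> (inv_into UNIV n k)) else k)" for \<beta> k
  have set3: "{1..3} = {1, 2, 3::nat}" by auto
  have "inj n" by (auto simp: inj_def n_def split: tri.splits)
  have n: "bij_betw n UNIV {1..3}"
    using \<open>inj n\<close> by (auto simp: bij_betw_def UNIV_tri n_def set3)
  have \<Phi>_n: "\<Phi> \<beta> (n x) = n (\<beta> x)" for \<beta> x
    using \<open>inj n\<close> bij_betwE[OF n] by (simp add: \<Phi>_def del: atLeastAtMost_iff)
  have permutes: "\<Phi> \<beta> permutes {1..3}" if "bij \<beta>" for \<beta>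
    using permutes_bij_inv_into[OF _ n, of \<beta>] bij_imp_permutes[of \<beta> UNIV] that
    by (simp add: \<Phi>_def[abs_def])
  have hom: "\<Phi> \<in> hom S_tri (sym_group 3)"
  proof (rule homI)
    fix \<beta> \<beta>' assume "\<beta> \<in> carrier S_tri" "\<beta>' \<in> carrier S_tri"
    moreover have "\<Phi> (\<beta> \<circ> \<beta>') = \<Phi> \<beta> \<circ> \<Phi> \<beta>'"
    proof
      fix k
      show "\<Phi> (\<beta> \<circ> \<beta>') k = (\<Phi> \<beta> \<circ> \<Phi> \<beta>') k"
      proof (cases "k \<in> {1..3}")
        case True
        then obtain x where "k = n x" using bij_betw_imp_surj_on[OF n] by blast
        then show ?thesis by (simp add: \<Phi>_n)
      next
        case False
        then show ?thesis by (simp only: \<Phi>_def comp_apply if_False)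
      qed
    qed
    ultimately show "\<Phi> (\<beta> \<otimes>\<^bsub>S_tri\<^esub> \<beta>') = \<Phi> \<beta> \<otimes>\<^bsub>sym_group 3\<^esub> \<Phi> \<beta>'"
      by (simp add: carrier_S mult_S sym_group_mult)
  qed (simp only: permutes carrier_S sym_group_carrier mem_Collect_eq)
  have "inj \<Phi>"
  proof (rule injI)
    fix \<beta> \<beta>' assume "\<Phi> \<beta> = \<Phi> \<beta>'"
    then show "\<beta> = \<beta>'" using \<Phi>_n \<open>inj n\<close> by (metis ext injD)
  qed
  moreover have "\<Phi> ` carrier S_tri = carrier (sym_group 3)"
  proof (rule card_subset_eq)
    show "\<Phi> ` carrier S_tri \<subseteq> carrier (sym_group 3)" using hom by (auto simp: hom_def)
    have "carrier S_tri = {p. p permutes UNIV}"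
      by (auto simp: carrier_S permutes_bij intro: bij_imp_permutes)
    then have "card (carrier S_tri) = fact 3"
      using card_permutations[of "UNIV :: tri set" 3] by (simp add: UNIV_tri)
    then show "card (\<Phi> ` carrier S_tri) = card (carrier (sym_group 3))"
      using \<open>inj \<Phi>\<close> by (simp add: card_image inj_on_subset sym_group_card_carrier)
    then show "finite (carrier (sym_group 3))"
      by (intro card_ge_0_finite) (simp add: sym_group_card_carrier)
  qed
  ultimately have "\<Phi> \<in> iso S_tri (sym_group 3)"
    using hom inj_on_subset[OF \<open>inj \<Phi>\<close> subset_UNIV] by (simp add: iso_def bij_betw_def)
  then show ?thesis by (auto simp: is_iso_def)
qed

section \<open>The admissible pairs of permutations in each of the fourteen cases\<close>

context perspectives
begin

lemmas case_simps = all_tri inv_rho inv_rho_rho inv_sigma P_rho_eq R_varrho_eq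
  fun_eq_tri fun_eq_idx ex_tri ex_idx

lemma carrier_i_ii_iii:
  assumes "\<xi> I1 I2 = rho \<and> \<xi> I2 I3 = rho \<and> \<xi> I1 I3 = rho \<and> i0 = I2 \<or>
    \<xi> I1 I2 = rho \<and> \<xi> I2 I3 = rho \<and> \<xi> I1 I3 = id \<and> i0 = I2 \<or>
    \<xi> I1 I2 = rho \<and> \<xi> I1 I3 = id \<and> \<xi> I2 I3 = id \<and> i0 = I3"
  shows "carrier (tp_aut_group \<xi>) =
    {times_map \<beta> \<alpha> |\<alpha> \<beta>. \<alpha> \<in> carrier S_idx \<and> \<beta> \<in> carrier S_tri \<and>
      (\<alpha> = id \<and> \<beta> \<in> P_rho \<or> \<alpha> = sigma_idx i0 \<and> (\<exists>x. \<beta> = sigma x))}"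
  using assms
  by (elim disjE conjE) (rule carrier_tp_aut_groupI, assumption+; simp add: case_simps)+

lemma carrier_iv:
  assumes "\<xi> I1 I2 = rho" "\<xi> I2 I3 = rho" "\<xi> I3 I1 = rho"
  shows "carrier (tp_aut_group \<xi>) =
    {times_map \<beta> \<alpha> |\<alpha> \<beta>. \<alpha> \<in> carrier S_idx \<and> \<beta> \<in> carrier S_tri \<and>
      (\<alpha> \<in> R_varrho \<and> \<beta> \<in> P_rho \<or> (\<exists>i x. (\<alpha>, \<beta>) = (sigma_idx i, sigma x)))}"
proof -
  \<comment> \<open>The case prescribes \<open>\<xi> I3 I1\<close>, while the criterion expects
    \<open>\<xi> I1 I3\<close>: the inverse of \<open>rho\<close>, written as its square.\<close>
  have "\<xi> I1 I3 = rho \<circ> rho" using xi_swap[of I1 I3] assms by (simp add: inv_rho)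
  then show ?thesis
    by (rule carrier_tp_aut_groupI[OF assms(1,2)]; simp add: case_simps)
qed

lemma carrier_v:
  assumes "\<xi> I1 I2 = rho" "\<xi> I3 I2 = rho" "\<xi> I1 I3 = id"
  shows "carrier (tp_aut_group \<xi>) =
    {times_map \<beta> \<alpha> |\<alpha> \<beta>. \<alpha> \<in> carrier S_idx \<and> \<beta> \<in> carrier S_tri \<and>
      \<alpha> \<in> {id, sigma_idx I2} \<and> \<beta> \<in> P_rho}"
proof -
  have "\<xi> I2 I3 = rho \<circ> rho" using xi_swap[of I2 I3] assms by (simp add: inv_rho)
  then show ?thesis
    by (rule carrier_tp_aut_groupI[OF assms(1) _ assms(3)]; simp add: case_simps)
qed

lemma carrier_vi:
  assumes "\<xi> I1 I2 = sigma Ta" "\<xi> I1 I3 = sigma Tc" "\<xi> I2 I3 = sigma Tb"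
  shows "carrier (tp_aut_group \<xi>) =
    {times_map \<beta> \<alpha> |\<alpha> \<beta>. \<alpha> \<in> carrier S_idx \<and> \<beta> \<in> carrier S_tri \<and>
      ((\<exists>m::nat \<in> {0, 1, 2}. (\<alpha>, \<beta>) = (varrho ^^ m, rho ^^ m)) \<or>
       (\<exists>(x, i) \<in> {(Tb, I1), (Tc, I2), (Ta, I3)}. (\<alpha>, \<beta>) = (sigma_idx i, sigma x)))}"
  by (rule carrier_tp_aut_groupI[OF assms(1,3,2)]; simp add: case_simps numeral_2_eq_2)

lemma carrier_vii_ix_x_xii_xiii:
  assumes "\<xi> I1 I2 = sigma Ta \<and> \<xi> I2 I3 = sigma Tc \<and> \<xi> I1 I3 = id \<and> x0 = Tb \<or>
    \<xi> I1 I2 = sigma Ta \<and> \<xi> I2 I3 = sigma Tc \<and> \<xi> I1 I3 = rho \<and> x0 = Tb \<or>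
    \<xi> I1 I2 = sigma Ta \<and> \<xi> I2 I3 = sigma Tc \<and> \<xi> I3 I1 = rho \<and> x0 = Tb \<or>
    \<xi> I1 I2 = sigma Tc \<and> \<xi> I2 I3 = sigma Tc \<and> \<xi> I1 I3 = rho \<and> x0 = Tc \<or>
    \<xi> I1 I2 = rho \<and> \<xi> I2 I3 = rho \<and> \<xi> I1 I3 = sigma Tc \<and> x0 = Tc"
  shows "carrier (tp_aut_group \<xi>) =
    {times_map \<beta> \<alpha> |\<alpha> \<beta>. \<alpha> \<in> carrier S_idx \<and> \<beta> \<in> carrier S_tri \<and>
      ((\<alpha>, \<beta>) = (id, id) \<or> (\<alpha>, \<beta>) = (sigma_idx I2, sigma x0))}"
proof -
  \<comment> \<open>Only the third alternative is given through \<open>\<xi> I3 I1\<close>;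
    rewriting it puts all five into the shape the criterion expects.\<close>
  have "\<xi> I1 I3 = rho \<circ> rho" if "\<xi> I3 I1 = rho"
    using xi_swap[of I1 I3] that by (simp add: inv_rho)
  with assms have "\<xi> I1 I2 = sigma Ta \<and> \<xi> I2 I3 = sigma Tc \<and> \<xi> I1 I3 = id \<and> x0 = Tb \<or>
      \<xi> I1 I2 = sigma Ta \<and> \<xi> I2 I3 = sigma Tc \<and> \<xi> I1 I3 = rho \<and> x0 = Tb \<or>
      \<xi> I1 I2 = sigma Ta \<and> \<xi> I2 I3 = sigma Tc \<and> \<xi> I1 I3 = rho \<circ> rho \<and> x0 = Tb \<or>
      \<xi> I1 I2 = sigma Tc \<and> \<xi> I2 I3 = sigma Tc \<and> \<xi> I1 I3 = rho \<and> x0 = Tc \<or>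
      \<xi> I1 I2 = rho \<and> \<xi> I2 I3 = rho \<and> \<xi> I1 I3 = sigma Tc \<and> x0 = Tc"
    by blast
  then show ?thesis
    by (elim disjE conjE) (rule carrier_tp_aut_groupI, assumption+; simp add: case_simps)+
qed

lemma carrier_viii:
  assumes "\<xi> I1 I2 = sigma Ta" "\<xi> I2 I3 = rho" "\<xi> I1 I3 = id"
  shows "carrier (tp_aut_group \<xi>) =
    {times_map \<beta> \<alpha> |\<alpha> \<beta>. \<alpha> \<in> carrier S_idx \<and> \<beta> \<in> carrier S_tri \<and> \<alpha> = id \<and> \<beta> = id}"
  by (rule carrier_tp_aut_groupI[OF assms]; simp add: case_simps)

lemma carrier_xi_xiv:
  assumes "\<xi> I1 I2 = sigma Tc \<and> \<xi> I2 I3 = sigma Tc \<and> \<xi> I1 I3 = sigma Ta \<or>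
    \<xi> I1 I2 = rho \<and> \<xi> I2 I3 = inv\<^bsub>S_tri\<^esub> rho \<and> \<xi> I1 I3 = sigma Tc"
  shows "carrier (tp_aut_group \<xi>) =
    {times_map \<beta> \<alpha> |\<alpha> \<beta>. \<alpha> \<in> carrier S_idx \<and> \<beta> \<in> carrier S_tri \<and>
      \<alpha> \<in> {id, sigma_idx I2} \<and> \<beta> = id}"
  using assms unfolding inv_S[OF bij_perm(1)] inv_rho
  by (elim disjE conjE) (rule carrier_tp_aut_groupI, assumption+; simp add: case_simps)+

end

section \<open>Isomorphism types through explicit embeddings\<close>

lemma sigma_rho: "sigma Tc \<circ> rho = rho \<circ> rho \<circ> sigma Tc"
  by (simp add: fun_eq_tri)

lemma sigma_idx_varrho: "sigma_idx I3 \<circ> varrho = varrho \<circ> varrho \<circ> sigma_idx I3"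
  by (simp add: fun_eq_idx)

lemmas iso_simps = carrier_cyclic_semidirect carrier_Z2 carrier_Z3 rot3_def flip2_def P_rho_eq
  R_varrho_eq fun_eq_tri fun_eq_idx ex_tri ex_idx

lemma carrier_S_tri: "carrier S_tri = perms_tri"
  by (simp only: carrier_S bij_tri_iff Collect_mem_eq)

text \<open>The rotation \<open>rho\<close> and the flip \<open>sigma Tc\<close> satisfy the
  dihedral relations and so give a homomorphism; its kernel is trivial and its values exhaust the
  six permutations.\<close>

lemma cyclic_semidirect_Z3_iso_S_tri: "cyclic_semidirect (integer_mod_group 3) \<cong> S_tri"
proof -
  let ?H = "cyclic_semidirect (integer_mod_group 3)"
  let ?\<psi> = "\<lambda>(h, n). rot3 rho n \<circ> flip2 (sigma Tc) h"
  have comm: "comm_group (integer_mod_group 3)" by simp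
  have hom: "?\<psi> \<in> hom ?H S_tri"
    by (rule dihedral_hom[where f = "\<lambda>n. n"])
      (simp_all add: hom_def rho_rho_rho sigma_sigma sigma_rho)
  interpret \<psi>: group_hom ?H S_tri ?\<psi>
    using hom group_cyclic_semidirect[OF comm] group_BijGroup
    by (simp add: group_hom_def group_hom_axioms_def)
  have "inj_on ?\<psi> (carrier ?H)"
    unfolding \<psi>.inj_on_one_iff
    by (simp add: iso_simps one_S) (simp add: semidirect_def)
  moreover have "?\<psi> ` carrier ?H = carrier S_tri"
    unfolding carrier_S_tri by (auto simp: iso_simps)
  ultimately show ?thesis
    using hom unfolding is_iso_def iso_def bij_betw_def by blast
qed

context perspectives
begin

text \<open>The cyclic part acts on labels only, so the index component takes \<open>id\<close> as
  rotation. The flip acts by \<open>sigma Tc\<close> on labels and simultaneously by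
  \<open>sigma_idx i0\<close> on indices.\<close>

lemma iso_i_ii_iii:
  assumes "carrier (tp_aut_group \<xi>) =
    {times_map \<beta> \<alpha> |\<alpha> \<beta>. \<alpha> \<in> carrier S_idx \<and> \<beta> \<in> carrier S_tri \<and>
      (\<alpha> = id \<and> \<beta> \<in> P_rho \<or> \<alpha> = sigma_idx i0 \<and> (\<exists>x. \<beta> = sigma x))}"
  shows "tp_aut_group \<xi> \<cong> cyclic_semidirect (integer_mod_group 3)"
proof (rule tp_aut_group_iso[OF assms])
  let ?H = "cyclic_semidirect (integer_mod_group 3)"
  let ?\<psi> = "\<lambda>x. ((\<lambda>(h, n). rot3 rho n \<circ> flip2 (sigma Tc) h) x,
    (\<lambda>(h, n). rot3 id n \<circ> flip2 (sigma_idx i0) h) x)"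
  show "group ?H" by (rule group_cyclic_semidirect) simp
  show "?\<psi> \<in> hom ?H (S_tri \<times>\<times> S_idx)"
    unfolding hom_paired
    by (intro conjI dihedral_hom[where f = "\<lambda>n. n"])
      (simp_all add: hom_def rho_rho_rho sigma_sigma sigma_rho sigma_idx_sigma_idx)
  show "\<forall>h\<in>carrier ?H. ?\<psi> h = (id, id) \<longrightarrow> h = \<one>\<^bsub>?H\<^esub>"
    by (simp add: iso_simps) (simp add: semidirect_def)
  show "\<forall>\<alpha>\<in>perms_idx. \<forall>\<beta>\<in>perms_tri.
      (\<alpha> = id \<and> \<beta> \<in> P_rho \<or> \<alpha> = sigma_idx i0 \<and> (\<exists>x. \<beta> = sigma x)) \<longleftrightarrow>
      (\<beta>, \<alpha>) \<in> ?\<psi> ` carrier ?H"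
    by (cases i0) (simp_all add: iso_simps insert_Times_insert)
qed

text \<open>The independent rotations of labels and of indices are both inverted by the single
  involution pairing \<open>sigma Tc\<close> with \<open>sigma_idx I3\<close>. The projections
  \<open>fst\<close> and \<open>snd\<close> distribute the normal subgroup over the two
  components.\<close>

lemma iso_iv:
  assumes "carrier (tp_aut_group \<xi>) =
    {times_map \<beta> \<alpha> |\<alpha> \<beta>. \<alpha> \<in> carrier S_idx \<and> \<beta> \<in> carrier S_tri \<and>
      (\<alpha> \<in> R_varrho \<and> \<beta> \<in> P_rho \<or> (\<exists>i x. (\<alpha>, \<beta>) = (sigma_idx i, sigma x)))}"
  shows "tp_aut_group \<xi> \<cong> cyclic_semidirect (integer_mod_group 3 \<times>\<times> integer_mod_group 3)"
proof (rule tp_aut_group_iso[OF assms])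
  let ?N = "integer_mod_group 3 \<times>\<times> integer_mod_group 3"
  let ?H = "cyclic_semidirect ?N"
  let ?\<psi> = "\<lambda>x. ((\<lambda>(h, n). rot3 rho (fst n) \<circ> flip2 (sigma Tc) h) x,
    (\<lambda>(h, n). rot3 varrho (snd n) \<circ> flip2 (sigma_idx I3) h) x)"
  have comm: "comm_group ?N"
    by (rule group.group_comm_groupI) (auto simp: DirProd_group add.commute)
  then show "group ?H" by (rule group_cyclic_semidirect)
  show "?\<psi> \<in> hom ?H (S_tri \<times>\<times> S_idx)"
    unfolding hom_paired
    by (intro conjI dihedral_hom[OF comm])
      (auto simp: hom_def mult_DirProd' rho_rho_rho varrho_varrho_varrho sigma_sigma sigma_rho
        sigma_idx_varrho sigma_idx_sigma_idx)
  show "\<forall>h\<in>carrier ?H. ?\<psi> h = (id, id) \<longrightarrow> h = \<one>\<^bsub>?H\<^esub>"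
    by (simp add: iso_simps) (simp add: semidirect_def)
  show "\<forall>\<alpha>\<in>perms_idx. \<forall>\<beta>\<in>perms_tri.
      (\<alpha> \<in> R_varrho \<and> \<beta> \<in> P_rho \<or> (\<exists>i x. (\<alpha>, \<beta>) = (sigma_idx i, sigma x))) \<longleftrightarrow>
      (\<beta>, \<alpha>) \<in> ?\<psi> ` carrier ?H"
    by (simp add: iso_simps insert_Times_insert)
qed

text \<open>The flip moves indices only and the rotation labels only, so they commute and the
  product is direct.\<close>

lemma iso_v:
  assumes "carrier (tp_aut_group \<xi>) =
    {times_map \<beta> \<alpha> |\<alpha> \<beta>. \<alpha> \<in> carrier S_idx \<and> \<beta> \<in> carrier S_tri \<and>
      \<alpha> \<in> {id, sigma_idx I2} \<and> \<beta> \<in> P_rho}"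
  shows "tp_aut_group \<xi> \<cong> integer_mod_group 2 \<times>\<times> integer_mod_group 3"
proof (rule tp_aut_group_iso[OF assms])
  let ?H = "integer_mod_group 2 \<times>\<times> integer_mod_group 3"
  let ?\<psi> = "\<lambda>x. ((rot3 rho \<circ> snd) x, (flip2 (sigma_idx I2) \<circ> fst) x)"
  show "group ?H" by (simp add: DirProd_group)
  show "?\<psi> \<in> hom ?H (S_tri \<times>\<times> S_idx)"
    unfolding hom_paired
    by (simp add: hom_of_fst[unfolded comp_def] hom_of_snd[unfolded comp_def]
        rot3_hom flip2_hom rho_rho_rho sigma_idx_sigma_idx)
  show "\<forall>h\<in>carrier ?H. ?\<psi> h = (id, id) \<longrightarrow> h = \<one>\<^bsub>?H\<^esub>"
    by (simp add: iso_simps)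
  show "\<forall>\<alpha>\<in>perms_idx. \<forall>\<beta>\<in>perms_tri. \<alpha> \<in> {id, sigma_idx I2} \<and> \<beta> \<in> P_rho \<longleftrightarrow>
      (\<beta>, \<alpha>) \<in> ?\<psi> ` carrier ?H"
    by (simp add: iso_simps insert_Times_insert)
qed

text \<open>The pairs form the graph of an isomorphism from \<open>S_tri\<close> to
  \<open>S_idx\<close>: conjugation by the bijection \<open>\<theta>\<close> matching
  \<open>Tb\<close>, \<open>Tc\<close>, \<open>Ta\<close> with \<open>I1\<close>, \<open>I2\<close>,
  \<open>I3\<close>.\<close>

lemma iso_vi:
  assumes "carrier (tp_aut_group \<xi>) =
    {times_map \<beta> \<alpha> |\<alpha> \<beta>. \<alpha> \<in> carrier S_idx \<and> \<beta> \<in> carrier S_tri \<and>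
      ((\<exists>m::nat \<in> {0, 1, 2}. (\<alpha>, \<beta>) = (varrho ^^ m, rho ^^ m)) \<or>
       (\<exists>(x, i) \<in> {(Tb, I1), (Tc, I2), (Ta, I3)}. (\<alpha>, \<beta>) = (sigma_idx i, sigma x)))}"
  shows "tp_aut_group \<xi> \<cong> S_tri"
proof (rule tp_aut_group_iso[OF assms group_BijGroup])
  define \<theta> where "\<theta> x = (case x of Tb \<Rightarrow> I1 | Tc \<Rightarrow> I2 | Ta \<Rightarrow> I3)" for x
  define \<theta>' where "\<theta>' i = (case i of I1 \<Rightarrow> Tb | I2 \<Rightarrow> Tc | I3 \<Rightarrow> Ta)" for i
  let ?\<psi> = "\<lambda>\<beta>. (\<beta>, \<theta> \<circ> \<beta> \<circ> \<theta>')"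
  have inv: "\<theta>' (\<theta> x) = x" "\<theta> (\<theta>' i) = i" for x i
    by (auto simp: \<theta>_def \<theta>'_def split: tri.split idx.split)
  then have "bij \<theta>" "bij \<theta>'" by (auto intro!: o_bij simp: fun_eq_iff)
  then have bij: "bij (\<theta> \<circ> \<beta> \<circ> \<theta>')" if "bij \<beta>" for \<beta> using that by (intro bij_comp)
  show "?\<psi> \<in> hom S_tri (S_tri \<times>\<times> S_idx)"
    by (rule homI) (auto simp: carrier_S mult_S bij fun_eq_iff inv)
  show "\<forall>\<beta>\<in>carrier S_tri. ?\<psi> \<beta> = (id, id) \<longrightarrow> \<beta> = \<one>\<^bsub>S_tri\<^esub>"
    by (simp add: one_S)
  show "\<forall>\<alpha>\<in>perms_idx. \<forall>\<beta>\<in>perms_tri.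
      ((\<exists>m::nat \<in> {0, 1, 2}. (\<alpha>, \<beta>) = (varrho ^^ m, rho ^^ m)) \<or>
       (\<exists>(x, i) \<in> {(Tb, I1), (Tc, I2), (Ta, I3)}. (\<alpha>, \<beta>) = (sigma_idx i, sigma x))) \<longleftrightarrow>
      (\<beta>, \<alpha>) \<in> ?\<psi> ` carrier S_tri"
    by (simp add: carrier_S_tri image_insert fun_eq_tri fun_eq_idx \<theta>_def \<theta>'_def numeral_2_eq_2)
qed

text \<open>The permutation \<open>s\<close> may be \<open>id\<close>: the index component
  \<open>sigma_idx i\<close> is nontrivial and already makes the homomorphism injective.\<close>

lemma iso_Z2:
  assumes "carrier (tp_aut_group \<xi>) =
      {times_map \<beta> \<alpha> |\<alpha> \<beta>. \<alpha> \<in> carrier S_idx \<and> \<beta> \<in> carrier S_tri \<and> D \<alpha> \<beta>}"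
    and D: "\<And>\<alpha> \<beta>. D \<alpha> \<beta> \<longleftrightarrow> (\<alpha>, \<beta>) = (id, id) \<or> (\<alpha>, \<beta>) = (sigma_idx i, s)"
    and s: "s \<circ> s = id"
  shows "tp_aut_group \<xi> \<cong> integer_mod_group 2"
proof (rule tp_aut_group_iso[OF assms(1) group_integer_mod_group])
  let ?H = "integer_mod_group 2"
  let ?\<psi> = "\<lambda>h. (flip2 s h, flip2 (sigma_idx i) h)"
  show "?\<psi> \<in> hom ?H (S_tri \<times>\<times> S_idx)"
    unfolding hom_paired using s by (simp add: flip2_hom sigma_idx_sigma_idx)
  show "\<forall>h\<in>carrier ?H. ?\<psi> h = (id, id) \<longrightarrow> h = \<one>\<^bsub>?H\<^esub>"
    by (cases i) (simp_all add: iso_simps)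
  show "\<forall>\<alpha>\<in>perms_idx. \<forall>\<beta>\<in>perms_tri. D \<alpha> \<beta> \<longleftrightarrow> (\<beta>, \<alpha>) \<in> ?\<psi> ` carrier ?H"
    by (auto simp: carrier_Z2 flip2_def D)
qed

end

theorem proposition2p14:
  fixes \<xi> :: "idx \<Rightarrow> idx \<Rightarrow> tri \<Rightarrow> tri"
  assumes "perspective_datum \<xi>"
  shows
    \<comment> \<open>(i), (ii), (iii)\<close>
    "(\<forall>i0.
        (\<xi> I1 I2 = rho \<and> \<xi> I2 I3 = rho \<and> \<xi> I1 I3 = rho \<and> i0 = I2) \<or>
        (\<xi> I1 I2 = rho \<and> \<xi> I2 I3 = rho \<and> \<xi> I1 I3 = id \<and> i0 = I2) \<or>
        (\<xi> I1 I2 = rho \<and> \<xi> I1 I3 = id \<and> \<xi> I2 I3 = id \<and> i0 = I3) \<longrightarrow>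
        carrier (tp_aut_group \<xi>) =
          {times_map \<beta> \<alpha> |\<alpha> \<beta>. \<alpha> \<in> carrier S_idx \<and> \<beta> \<in> carrier S_tri \<and>
            (\<alpha> = id \<and> \<beta> \<in> P_rho \<or> \<alpha> = sigma_idx i0 \<and> (\<exists>x. \<beta> = sigma x))} \<and>
        tp_aut_group \<xi> \<cong> cyclic_semidirect (integer_mod_group 3) \<and>
        tp_aut_group \<xi> \<cong> sym_group 3)
     \<and> \<comment> \<open>(iv)\<close>
     (\<xi> I1 I2 = rho \<and> \<xi> I2 I3 = rho \<and> \<xi> I3 I1 = rho \<longrightarrow>
        carrier (tp_aut_group \<xi>) =
          {times_map \<beta> \<alpha> |\<alpha> \<beta>. \<alpha> \<in> carrier S_idx \<and> \<beta> \<in> carrier S_tri \<and>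
            (\<alpha> \<in> R_varrho \<and> \<beta> \<in> P_rho \<or> (\<exists>i x. (\<alpha>, \<beta>) = (sigma_idx i, sigma x)))} \<and>
        tp_aut_group \<xi> \<cong> cyclic_semidirect (integer_mod_group 3 \<times>\<times> integer_mod_group 3))
     \<and> \<comment> \<open>(v)\<close>
     (\<xi> I1 I2 = rho \<and> \<xi> I3 I2 = rho \<and> \<xi> I1 I3 = id \<longrightarrow>
        carrier (tp_aut_group \<xi>) =
          {times_map \<beta> \<alpha> |\<alpha> \<beta>. \<alpha> \<in> carrier S_idx \<and> \<beta> \<in> carrier S_tri \<and>
            \<alpha> \<in> {id, sigma_idx I2} \<and> \<beta> \<in> P_rho} \<and>
        tp_aut_group \<xi> \<cong> integer_mod_group 2 \<times>\<times> integer_mod_group 3)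
     \<and> \<comment> \<open>(vi)\<close>
     (\<xi> I1 I2 = sigma Ta \<and> \<xi> I1 I3 = sigma Tc \<and> \<xi> I2 I3 = sigma Tb \<longrightarrow>
        carrier (tp_aut_group \<xi>) =
          {times_map \<beta> \<alpha> |\<alpha> \<beta>. \<alpha> \<in> carrier S_idx \<and> \<beta> \<in> carrier S_tri \<and>
            ((\<exists>m::nat \<in> {0, 1, 2}. (\<alpha>, \<beta>) = (varrho ^^ m, rho ^^ m)) \<or>
             (\<exists>(x, i) \<in> {(Tb, I1), (Tc, I2), (Ta, I3)}. (\<alpha>, \<beta>) = (sigma_idx i, sigma x)))} \<and>
        tp_aut_group \<xi> \<cong> S_tri \<and>
        tp_aut_group \<xi> \<cong> sym_group 3)
     \<and> \<comment> \<open>(vii), (ix), (x), (xii), (xiii)\<close>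
     (\<forall>x0.
        (\<xi> I1 I2 = sigma Ta \<and> \<xi> I2 I3 = sigma Tc \<and> \<xi> I1 I3 = id \<and> x0 = Tb) \<or>
        (\<xi> I1 I2 = sigma Ta \<and> \<xi> I2 I3 = sigma Tc \<and> \<xi> I1 I3 = rho \<and> x0 = Tb) \<or>
        (\<xi> I1 I2 = sigma Ta \<and> \<xi> I2 I3 = sigma Tc \<and> \<xi> I3 I1 = rho \<and> x0 = Tb) \<or>
        (\<xi> I1 I2 = sigma Tc \<and> \<xi> I2 I3 = sigma Tc \<and> \<xi> I1 I3 = rho \<and> x0 = Tc) \<or>
        (\<xi> I1 I2 = rho \<and> \<xi> I2 I3 = rho \<and> \<xi> I1 I3 = sigma Tc \<and> x0 = Tc) \<longrightarrow>
        carrier (tp_aut_group \<xi>) =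
          {times_map \<beta> \<alpha> |\<alpha> \<beta>. \<alpha> \<in> carrier S_idx \<and> \<beta> \<in> carrier S_tri \<and>
            ((\<alpha>, \<beta>) = (id, id) \<or> (\<alpha>, \<beta>) = (sigma_idx I2, sigma x0))} \<and>
        tp_aut_group \<xi> \<cong> integer_mod_group 2)
     \<and> \<comment> \<open>(viii)\<close>
     (\<xi> I1 I2 = sigma Ta \<and> \<xi> I2 I3 = rho \<and> \<xi> I1 I3 = id \<longrightarrow>
        carrier (tp_aut_group \<xi>) =
          {times_map \<beta> \<alpha> |\<alpha> \<beta>. \<alpha> \<in> carrier S_idx \<and> \<beta> \<in> carrier S_tri \<and>
            \<alpha> = id \<and> \<beta> = id})
     \<and> \<comment> \<open>(xi), (xiv)\<close>
     ((\<xi> I1 I2 = sigma Tc \<and> \<xi> I2 I3 = sigma Tc \<and> \<xi> I1 I3 = sigma Ta) \<or>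
      (\<xi> I1 I2 = rho \<and> \<xi> I2 I3 = inv\<^bsub>S_tri\<^esub> rho \<and> \<xi> I1 I3 = sigma Tc) \<longrightarrow>
        carrier (tp_aut_group \<xi>) =
          {times_map \<beta> \<alpha> |\<alpha> \<beta>. \<alpha> \<in> carrier S_idx \<and> \<beta> \<in> carrier S_tri \<and>
            \<alpha> \<in> {id, sigma_idx I2} \<and> \<beta> = id} \<and>
        tp_aut_group \<xi> \<cong> integer_mod_group 2)"
proof -
  interpret perspectives \<xi> using assms by unfold_locales
  have sym: "tp_aut_group \<xi> \<cong> sym_group 3" if "tp_aut_group \<xi> \<cong> S_tri"
    using iso_trans[OF that S_tri_iso_sym_group] .
  have dihedral: "tp_aut_group \<xi> \<cong> S_tri" if "tp_aut_group \<xi> \<cong> cyclic_semidirect (integer_mod_group 3)"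
    using iso_trans[OF that cyclic_semidirect_Z3_iso_S_tri] .
  show ?thesis
  \<comment> \<open>Prescribing the shape of the first conjunct splits the statement into its seven
    blocks and leaves the conjunctions inside their conclusions intact.\<close>
  proof (intro conjI[of "\<forall>i. _ i"] conjI[of "_ \<longrightarrow> _"] allI impI, goal_cases)
    case (1 i0)
    note c = carrier_i_ii_iii[OF 1]
    show ?case using c iso_i_ii_iii[OF c] dihedral sym by blast
  next
    case 2
    note c = carrier_iv[OF conjunct1[OF 2] conjunct1[OF conjunct2[OF 2]] conjunct2[OF conjunct2[OF 2]]]
    show ?case by (rule conjI[OF c iso_iv[OF c]])
  next
    case 3
    note c = carrier_v[OF conjunct1[OF 3] conjunct1[OF conjunct2[OF 3]] conjunct2[OF conjunct2[OF 3]]]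
    show ?case by (rule conjI[OF c iso_v[OF c]])
  next
    case 4
    note c = carrier_vi[OF conjunct1[OF 4] conjunct1[OF conjunct2[OF 4]] conjunct2[OF conjunct2[OF 4]]]
    show ?case by (intro conjI c iso_vi[OF c] sym)
  next
    case (5 x0)
    note c = carrier_vii_ix_x_xii_xiii[OF 5]
    show ?case by (rule conjI[OF c iso_Z2[OF c refl sigma_sigma]])
  next
    case 6
    show ?case
      by (rule carrier_viii[OF conjunct1[OF 6] conjunct1[OF conjunct2[OF 6]] conjunct2[OF conjunct2[OF 6]]])
  next
    case 7
    note c = carrier_xi_xiv[OF 7]
    \<comment> \<open>The label component is trivial here, hence \<open>s = id\<close>; the
      remaining premises compare the two descriptions of the pairs and square
      \<open>id\<close>.\<close>
    show ?case by (rule conjI[OF c iso_Z2[OF c, where s = id and i = I2]]) auto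
  qed
qed

end
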